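(* Let $M$ be a finite Markov chain with $m$ states and $\varphi$ a pLTL$_\Diamond$ formula. Then $V_{>0}(\varphi)\neq\emptyset$ if and only if $\bar v\in V_{>0}(\varphi)$, where $\bar v(x)=m\cdot|\varphi|\cdot 2^{|\varphi|}$ for every variable $x$.
   Context: pLTL$_\Diamond$ formulas (in negation normal form): $\varphi ::= a\mid\neg a\mid\varphi\wedge\varphi\mid\varphi\vee\varphi\mid X\varphi\mid\varphi\,U\,\varphi\mid\varphi\,R\,\varphi\mid\Box\varphi\mid\Diamond_{\le x}\varphi\mid\Diamond_{\le c}\varphi\mid\Box_{\le c}\varphi$ with $a$ an atomic proposition, $x$ a variable, $c\in\mathbb{N}$; $|\varphi|$ is the length of $\varphi$. A valuation $v$ assigns a natural number to each variable. Semantics on infinite words $w\in(2^{AP})^\omega$ at position $i$: usual LTL semantics ($R$ is release, the dual of until), $(w,i,v)\models\Diamond_{\le x}\psi$ iff $(w,j,v)\models\psi$ for some $i\le j\le i+v(x)$, $\Diamond_{\le c}$ likewise with constant $c$, and $(w,i,v)\models\Box_{\le c}\psi$ iff $(w,j,v)\models\psi$ for all $i\le j\le i+c$. For a finite Markov chain $M=(S,\mathbf P,s_0,L)$, $\Pr(M\models v(\varphi))$ is the probability of the set of paths from $s_0$ whose trace $L(s_0)L(s_1)\dots$ satisfies $\varphi$ under $v$ at position $0$, and $V_{>0}(\varphi)=\{v\mid\Pr(M\models v(\varphi))>0\}$.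
   Formalization: The length |φ| counts a constant bound c in unary (contributing c symbols, as when unfolded into nested X); if c counted as one symbol the claim fails, e.g. for □_{≤c}¬p ∧ ◇_{≤x}p with c large on a two-state chain. For formulas without constants |φ| is the usual symbol count. *)

theory Defs
  imports "HOL-Probability.Probability"
begin

datatype ('ap, 'x) pltl =
    Atom 'ap
  | NAtom 'ap
  | And "('ap, 'x) pltl" "('ap, 'x) pltl"
  | Or "('ap, 'x) pltl" "('ap, 'x) pltl"
  | Next "('ap, 'x) pltl"
  | Until "('ap, 'x) pltl" "('ap, 'x) pltl"
  | Release "('ap, 'x) pltl" "('ap, 'x) pltl"
  | Always "('ap, 'x) pltl"
  | EventuallyVar 'x "('ap, 'x) pltl"
  | EventuallyConst nat "('ap, 'x) pltl"
  | AlwaysConst nat "('ap, 'x) pltl"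

text \<open>
  The length is the number of symbols, where a negated atom \<open>\<not> a\<close> consists of two symbols, a
  bounded operator with a variable bound is one symbol, and a constant bound \<open>c\<close> is written in
  unary and hence contributes \<open>c\<close>. (With constants of length one, \<open>\<box>\<^sub>\<le>\<^sub>c \<not> p \<and> \<diamond>\<^sub>\<le>\<^sub>x p\<close> would have
  constant length but force the value of \<open>x\<close> to exceed \<open>c\<close>.)
\<close>

primrec len :: "('ap, 'x) pltl \<Rightarrow> nat" where
  "len (Atom a) = 1"
| "len (NAtom a) = 2"
| "len (And \<phi> \<psi>) = 1 + len \<phi> + len \<psi>"
| "len (Or \<phi> \<psi>) = 1 + len \<phi> + len \<psi>"
| "len (Next \<phi>) = 1 + len \<phi>"
| "len (Until \<phi> \<psi>) = 1 + len \<phi> + len \<psi>"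
| "len (Release \<phi> \<psi>) = 1 + len \<phi> + len \<psi>"
| "len (Always \<phi>) = 1 + len \<phi>"
| "len (EventuallyVar x \<phi>) = 1 + len \<phi>"
| "len (EventuallyConst c \<phi>) = 1 + c + len \<phi>"
| "len (AlwaysConst c \<phi>) = 1 + c + len \<phi>"

primrec sat :: "(nat \<Rightarrow> 'ap set) \<Rightarrow> nat \<Rightarrow> ('x \<Rightarrow> nat) \<Rightarrow> ('ap, 'x) pltl \<Rightarrow> bool" where
  "sat w i v (Atom a) \<longleftrightarrow> a \<in> w i"
| "sat w i v (NAtom a) \<longleftrightarrow> a \<notin> w i"
| "sat w i v (And \<phi> \<psi>) \<longleftrightarrow> sat w i v \<phi> \<and> sat w i v \<psi>"
| "sat w i v (Or \<phi> \<psi>) \<longleftrightarrow> sat w i v \<phi> \<or> sat w i v \<psi>"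
| "sat w i v (Next \<phi>) \<longleftrightarrow> sat w (Suc i) v \<phi>"
| "sat w i v (Until \<phi> \<psi>) \<longleftrightarrow> (\<exists>j\<ge>i. sat w j v \<psi> \<and> (\<forall>k. i \<le> k \<and> k < j \<longrightarrow> sat w k v \<phi>))"
| "sat w i v (Release \<phi> \<psi>) \<longleftrightarrow> (\<forall>j\<ge>i. sat w j v \<psi> \<or> (\<exists>k. i \<le> k \<and> k < j \<and> sat w k v \<phi>))"
| "sat w i v (Always \<phi>) \<longleftrightarrow> (\<forall>j\<ge>i. sat w j v \<phi>)"
| "sat w i v (EventuallyVar x \<phi>) \<longleftrightarrow> (\<exists>j. i \<le> j \<and> j \<le> i + v x \<and> sat w j v \<phi>)"
| "sat w i v (EventuallyConst c \<phi>) \<longleftrightarrow> (\<exists>j. i \<le> j \<and> j \<le> i + c \<and> sat w j v \<phi>)"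
| "sat w i v (AlwaysConst c \<phi>) \<longleftrightarrow> (\<forall>j. i \<le> j \<and> j \<le> i + c \<longrightarrow> sat w j v \<phi>)"

record ('s, 'ap) markov_chain =
  states :: "'s set"
  trans_prob :: "'s \<Rightarrow> 's pmf"
  init_state :: 's
  label :: "'s \<Rightarrow> 'ap set"

definition finite_markov_chain :: "('s, 'ap) markov_chain \<Rightarrow> bool" where
  "finite_markov_chain M \<longleftrightarrow>
     finite (states M) \<and> init_state M \<in> states M \<and>
     (\<forall>s\<in>states M. set_pmf (trans_prob M s) \<subseteq> states M)"

text \<open>
  The path measure is the limit of the kernels below, given by the Ionescu-Tulcea theorem;
  the kernel at step \<open>i\<close> yields the distribution of the \<open>i\<close>-th state given the states before it.
  The resulting probabilities of cylinder sets are stated in \<open>emeasure_path_measure_cylinder\<close>.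
\<close>

definition path_kernel :: "('s, 'ap) markov_chain \<Rightarrow> nat \<Rightarrow> (nat \<Rightarrow> 's) \<Rightarrow> 's measure" where
  "path_kernel M i \<omega> = measure_pmf
     (case i of 0 \<Rightarrow> return_pmf (init_state M) | Suc j \<Rightarrow> trans_prob M (\<omega> j))"

definition path_measure :: "('s, 'ap) markov_chain \<Rightarrow> (nat \<Rightarrow> 's) measure" where
  "path_measure M = projective_family.lim UNIV
     (Ionescu_Tulcea.CI (path_kernel M) (\<lambda>_. count_space UNIV)) (\<lambda>_. count_space UNIV)"

definition pr_sat :: "('s, 'ap) markov_chain \<Rightarrow> ('x \<Rightarrow> nat) \<Rightarrow> ('ap, 'x) pltl \<Rightarrow> real" where
  "pr_sat M v \<phi> = measure (path_measure M) {\<omega>. sat (\<lambda>i. label M (\<omega> i)) 0 v \<phi>}"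

definition V_pos :: "('s, 'ap) markov_chain \<Rightarrow> ('ap, 'x) pltl \<Rightarrow> ('x \<Rightarrow> nat) set" where
  "V_pos M \<phi> = {v. pr_sat M v \<phi> > 0}"


lemma Ionescu_Tulcea_path_kernel: "Ionescu_Tulcea (path_kernel M) (\<lambda>_. count_space UNIV)"
proof (rule Ionescu_Tulcea.intro)
  fix i
  show "path_kernel M i \<in> measurable (PiM {0..<i} (\<lambda>_. count_space UNIV))
          (subprob_algebra (count_space UNIV))"
  proof (cases i)
    case 0
    then show ?thesis
      by (simp add: path_kernel_def[abs_def] space_subprob_algebra
          measure_pmf.subprob_space_axioms)
  next
    case (Suc j)
    have "(\<lambda>s. measure_pmf (trans_prob M s)) \<in>
        measurable (count_space UNIV) (subprob_algebra (count_space UNIV))"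
      by (simp add: space_subprob_algebra measure_pmf.subprob_space_axioms)
    moreover have "(\<lambda>\<omega>. \<omega> j) \<in>
        measurable (PiM {0..<i} (\<lambda>_. count_space UNIV)) (count_space UNIV)"
      using Suc by (intro measurable_component_singleton) auto
    ultimately have "(\<lambda>\<omega>. measure_pmf (trans_prob M (\<omega> j))) \<in>
        measurable (PiM {0..<i} (\<lambda>_. count_space UNIV)) (subprob_algebra (count_space UNIV))"
      by (rule measurable_compose[rotated])
    then show ?thesis
      using Suc by (simp add: path_kernel_def[abs_def])
  qed
next
  fix i and x :: "nat \<Rightarrow> 'a"
  show "prob_space (path_kernel M i x)"
    by (simp add: path_kernel_def measure_pmf.prob_space_axioms)
qed

lemma prob_space_path_measure: "prob_space (path_measure M)"
proof -
  interpret Ionescu_Tulcea "path_kernel M" "\<lambda>_. count_space UNIV"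
    by (rule Ionescu_Tulcea_path_kernel)
  have "emeasure PF.lim (PF.emb UNIV {} {\<lambda>_. undefined}) = emeasure (CI {}) {\<lambda>_. undefined}"
    by (rule lim) (auto simp: sets_PiM_empty)
  moreover have "emeasure (CI {}) {\<lambda>_. undefined} = 1"
    using prob_space.emeasure_space_1[OF PF.prob_space_P, of "{}"]
    by (simp add: PF.space_P space_PiM)
  moreover have "PF.emb UNIV {} {\<lambda>_. undefined} = space PF.lim"
    by (auto simp: prod_emb_def PF.space_lim space_PiM)
  ultimately show ?thesis
    unfolding path_measure_def by (intro prob_spaceI) simp
qed

lemma sets_path_measure: "sets (path_measure M) = sets (PiM UNIV (\<lambda>_. count_space UNIV))"
proof -
  interpret Ionescu_Tulcea "path_kernel M" "\<lambda>_. count_space UNIV"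
    by (rule Ionescu_Tulcea_path_kernel)
  show ?thesis
    by (simp add: path_measure_def PF.sets_lim)
qed

lemma space_path_measure: "space (path_measure M) = UNIV"
  using sets_eq_imp_space_eq[OF sets_path_measure[of M]] by (simp add: space_PiM)

lemma emeasure_path_measure_cylinder:
  "emeasure (path_measure M) {\<omega>. \<forall>i\<le>n. \<omega> i = \<pi> i} =
     (if \<pi> 0 = init_state M then \<Prod>i<n. ennreal (pmf (trans_prob M (\<pi> i)) (\<pi> (Suc i))) else 0)"
proof -
  interpret Ionescu_Tulcea "path_kernel M" "\<lambda>_. count_space UNIV"
    by (rule Ionescu_Tulcea_path_kernel)
  let ?\<pi> = "\<lambda>n. restrict \<pi> {0..<n}" and ?P = "\<lambda>n. PiM {0..<n} (\<lambda>_::nat. count_space UNIV)"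
  have sp: "\<omega> \<in> space (?P n) \<longleftrightarrow> \<omega> \<in> extensional {0..<n}" for \<omega> :: "nat \<Rightarrow> 'a" and n
    by (simp add: space_PiM PiE_def)
  have sing: "{?\<pi> n} = PiE {0..<n} (\<lambda>i. {\<pi> i})" for n
    by (auto simp: PiE_def extensional_def fun_eq_iff Pi_def)
  have [measurable]: "{?\<pi> n} \<in> sets (?P n)" for n
    unfolding sing by (rule sets_PiM_I_finite) auto
  have C: "emeasure (C 0 n (\<lambda>_. undefined)) {?\<pi> n} =
      (\<Prod>i<n. emeasure (path_kernel M i \<pi>) {\<pi> i})" for n
  proof (induction n)
    case 0
    show ?case
      using emeasure_return[of "{?\<pi> 0}" "?P 0" "\<lambda>_. undefined"] \<open>{?\<pi> 0} \<in> sets (?P 0)\<close>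
      by (simp add: restrict_def)
  next
    case (Suc n)
    have C0: "(\<lambda>_. undefined) \<in> space (PiM {0..<0} (\<lambda>_::nat. count_space (UNIV :: 'a set)))"
      by simp
    have eP: "emeasure (eP n \<omega>) {?\<pi> (Suc n)} =
        emeasure (path_kernel M n \<pi>) {\<pi> n} * indicator {?\<pi> n} \<omega>"
      if \<omega>: "\<omega> \<in> space (?P n)" for \<omega>
    proof -
      have upd: "fun_upd \<omega> n x = ?\<pi> (Suc n) \<longleftrightarrow> \<omega> = ?\<pi> n \<and> x = \<pi> n" for x
      proof
        assume *: "fun_upd \<omega> n x = ?\<pi> (Suc n)"
        have "\<omega> k = ?\<pi> n k" for k
          using fun_cong[OF *, of k] \<omega> by (cases "k < n"; cases "k = n")
            (auto simp: sp extensional_def)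
        then show "\<omega> = ?\<pi> n \<and> x = \<pi> n"
          using fun_cong[OF *, of n] by auto
      qed (auto simp: fun_eq_iff)
      have "(\<lambda>x. fun_upd \<omega> n x) -` {?\<pi> (Suc n)} = (if \<omega> = ?\<pi> n then {\<pi> n} else {})"
        unfolding vimage_def singleton_iff upd by auto
      moreover have "path_kernel M n (?\<pi> n) = path_kernel M n \<pi>"
        by (simp add: path_kernel_def split: nat.split)
      ultimately show ?thesis
        using emeasure_eP[OF \<omega>, of "{?\<pi> (Suc n)}"] \<open>{?\<pi> (Suc n)} \<in> sets (?P (Suc n))\<close> by simp
    qed
    have "emeasure (C 0 (Suc n) (\<lambda>_. undefined)) {?\<pi> (Suc n)} =
        (\<integral>\<^sup>+\<omega>. emeasure (eP n \<omega>) {?\<pi> (Suc n)} \<partial>C 0 n (\<lambda>_. undefined))"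
      using measurable_eP[of n] C0
      by (simp add: emeasure_bind[where N="?P (Suc n)"] space_C[OF C0]
          measurable_cong_sets[OF sets_C[OF C0]])
    also have "\<dots> = (\<integral>\<^sup>+\<omega>. emeasure (path_kernel M n \<pi>) {\<pi> n} * indicator {?\<pi> n} \<omega>
        \<partial>C 0 n (\<lambda>_. undefined))"
      using space_C[OF C0, of n] by (intro nn_integral_cong) (simp add: eP)
    also have "\<dots> = emeasure (path_kernel M n \<pi>) {\<pi> n} *
        emeasure (C 0 n (\<lambda>_. undefined)) {?\<pi> n}"
      using sets_C[OF C0, of n] \<open>{?\<pi> n} \<in> sets (?P n)\<close>
      by (subst nn_integral_cmult_indicator) simp_all
    finally show ?case
      by (simp only: Suc.IH prod.lessThan_Suc mult.commute)
  qed
  have "{\<omega>. \<forall>i\<le>n. \<omega> i = \<pi> i} = PF.emb UNIV {0..<Suc n} {?\<pi> (Suc n)}"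
    by (auto simp: prod_emb_def space_PiM fun_eq_iff less_Suc_eq_le; metis)
  then have "emeasure (path_measure M) {\<omega>. \<forall>i\<le>n. \<omega> i = \<pi> i} =
      emeasure (CI {0..<Suc n}) {?\<pi> (Suc n)}"
    using lim[of "{0..<Suc n}" "{?\<pi> (Suc n)}"] by (simp add: path_measure_def)
  also have "\<dots> = emeasure (C 0 (Suc n) (\<lambda>_. undefined)) {?\<pi> (Suc n)}"
  proof -
    have "PF.emb {0..<Suc n} {0..<Suc n} {?\<pi> (Suc n)} = {?\<pi> (Suc n)}"
      by (rule prod_emb_id) auto
    then show ?thesis
      by (subst emeasure_CI[of _ "Suc n"]) (simp_all del: C.simps)
  qed
  also have "\<dots> = emeasure (path_kernel M 0 \<pi>) {\<pi> 0} *
      (\<Prod>i<n. emeasure (path_kernel M (Suc i) \<pi>) {\<pi> (Suc i)})"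
    by (simp only: C prod.lessThan_Suc_shift)
  finally show ?thesis
    by (auto simp: path_kernel_def emeasure_pmf_single indicator_def)
qed

lemma sets_sat [measurable]:
  "{\<omega>. sat (\<lambda>k. label M (\<omega> k)) i v \<phi>} \<in> sets (path_measure M)"
proof -
  let ?N = "PiM UNIV (\<lambda>_::nat. count_space UNIV)"
  have *: "Measurable.pred ?N (\<lambda>\<omega>. Q (\<omega> i))" for Q :: "'a \<Rightarrow> bool" and i
    by (rule measurable_compose[OF measurable_component_singleton[of i UNIV]]) auto
  have "Measurable.pred ?N (\<lambda>\<omega>. sat (\<lambda>k. label M (\<omega> k)) i v \<phi>)"
    by (induction \<phi> arbitrary: i) (simp_all add: *[of "\<lambda>s. _ \<in> label M s"] *[of "\<lambda>s. _ \<notin> label M s"])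
  then show ?thesis
    by (simp add: pred_def sets_path_measure space_PiM)
qed

end

theory Submission
  imports Defs
begin

text \<open>
  Almost every path is eventually confined to a bottom component \<open>B\<close> and repeats every finite path of
  \<open>B\<close> infinitely often. On such paths the truth of a formula is decided by a finite prefix: an
  obligation that lasts forever concerns a formula that holds almost surely in \<open>B\<close>. So a path
  satisfying the formula carries a finite certificate, a labelling of a prefix with the temporal
  subformulas claimed there. If the certificate is longer than the number of pairs of a state and a
  label, the part between two equal pairs can be cut out. In a shortest certificate all bounded
  eventualities are thus fulfilled within \<open>m * 2 ^ |\<phi>|\<close> steps. It remains to see that a formula which
  is almost sure in \<open>B\<close> for a large valuation stays so for the claimed one. Otherwise its negation has
  a certificate in which \<open>\<box>\<^sub>\<le>\<^sub>x \<psi>\<close> is maintained for \<open>m * |\<phi>| * 2 ^ |\<phi>|\<close> steps. Splitting this window where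
  one of the at most \<open>|\<phi>|\<close> concurrent obligations of this kind ends, one finds a repetition that can be
  pumped until all of them last as long as the large valuation demands. Finally, a certificate is
  sound for almost all paths in a cylinder, and that cylinder has positive probability.
\<close>

section \<open>Formulas closed under negation\<close>

text \<open>
  State formulas with one bound shared by all parametric modalities: \<open>Ev\<close> is the bounded eventually
  and \<open>Alw\<close> its dual. Only \<open>Ev\<close> arises from pLTL formulas, but negation turns it into \<open>Alw\<close>.
  Constant bounds are unfolded into \<open>Nxt\<close>; as \<open>tsub\<close> is a set, the copies are counted only once.
\<close>

datatype 's fm =
    Lit "'s \<Rightarrow> bool"
  | Conj "'s fm" "'s fm"
  | Disj "'s fm" "'s fm"
  | Nxt "'s fm"
  | Unt "'s fm" "'s fm"
  | Rel "'s fm" "'s fm"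
  | Ev "'s fm"
  | Alw "'s fm"

primrec fsat :: "nat \<Rightarrow> (nat \<Rightarrow> 's) \<Rightarrow> nat \<Rightarrow> 's fm \<Rightarrow> bool" where
  "fsat c w i (Lit P) \<longleftrightarrow> P (w i)"
| "fsat c w i (Conj f g) \<longleftrightarrow> fsat c w i f \<and> fsat c w i g"
| "fsat c w i (Disj f g) \<longleftrightarrow> fsat c w i f \<or> fsat c w i g"
| "fsat c w i (Nxt f) \<longleftrightarrow> fsat c w (Suc i) f"
| "fsat c w i (Unt f g) \<longleftrightarrow> (\<exists>j\<ge>i. fsat c w j g \<and> (\<forall>k. i \<le> k \<and> k < j \<longrightarrow> fsat c w k f))"
| "fsat c w i (Rel f g) \<longleftrightarrow> (\<forall>j\<ge>i. fsat c w j g \<or> (\<exists>k. i \<le> k \<and> k < j \<and> fsat c w k f))"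
| "fsat c w i (Ev f) \<longleftrightarrow> (\<exists>j. i \<le> j \<and> j \<le> i + c \<and> fsat c w j f)"
| "fsat c w i (Alw f) \<longleftrightarrow> (\<forall>j. i \<le> j \<and> j \<le> i + c \<longrightarrow> fsat c w j f)"

primrec neg :: "'s fm \<Rightarrow> 's fm" where
  "neg (Lit P) = Lit (\<lambda>s. \<not> P s)"
| "neg (Conj f g) = Disj (neg f) (neg g)"
| "neg (Disj f g) = Conj (neg f) (neg g)"
| "neg (Nxt f) = Nxt (neg f)"
| "neg (Unt f g) = Rel (neg f) (neg g)"
| "neg (Rel f g) = Unt (neg f) (neg g)"
| "neg (Ev f) = Alw (neg f)"
| "neg (Alw f) = Ev (neg f)"

text \<open>Only subformulas headed by a temporal operator are collected: these are the claims that
  a label may contain, so \<open>2 ^ card (tsub f)\<close> bounds the number of labels. Boolean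
  structure is left to \<open>loc\<close>.\<close>

primrec tsub :: "'s fm \<Rightarrow> 's fm set" where
  "tsub (Lit P) = {}"
| "tsub (Conj f g) = tsub f \<union> tsub g"
| "tsub (Disj f g) = tsub f \<union> tsub g"
| "tsub (Nxt f) = insert (Nxt f) (tsub f)"
| "tsub (Unt f g) = insert (Unt f g) (tsub f \<union> tsub g)"
| "tsub (Rel f g) = insert (Rel f g) (tsub f \<union> tsub g)"
| "tsub (Ev f) = insert (Ev f) (tsub f)"
| "tsub (Alw f) = insert (Alw f) (tsub f)"

lemma fsat_neg [simp]: "fsat c w i (neg f) \<longleftrightarrow> \<not> fsat c w i f"
  by (induction f arbitrary: i) auto

lemma neg_neg [simp]: "neg (neg f) = f"
  by (induction f) auto

lemma size_neg [simp]: "size (neg f) = size f"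
  by (induction f) auto

lemma tsub_neg: "tsub (neg f) = neg ` tsub f"
  by (induction f) (auto simp: image_Un)

lemma Ev_in_tsub_neg: "Ev h \<in> tsub (neg g) \<longleftrightarrow> Alw (neg h) \<in> tsub g"
  and Alw_in_tsub_neg: "Alw h \<in> tsub (neg g) \<longleftrightarrow> Ev (neg h) \<in> tsub g"
proof -
  have "h = neg g \<longleftrightarrow> neg h = g" for g :: "'a fm" by auto
  then show "Ev h \<in> tsub (neg g) \<longleftrightarrow> Alw (neg h) \<in> tsub g"
    "Alw h \<in> tsub (neg g) \<longleftrightarrow> Ev (neg h) \<in> tsub g"
    by (induction g) auto
qed

lemma finite_tsub [simp]: "finite (tsub f)"
  by (induction f) auto

lemma tsub_trans: "h \<in> tsub f \<Longrightarrow> tsub h \<subseteq> tsub f"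
  by (induction f) auto

lemma size_tsub: "h \<in> tsub f \<Longrightarrow> size h \<le> size f"
  by (induction f) auto

lemma card_tsub_neg: "card (tsub (neg f)) = card (tsub f)"
proof -
  have "inj_on neg (tsub f)"
    by (rule inj_on_inverseI[of _ neg]) simp
  then show ?thesis by (simp add: tsub_neg card_image)
qed

lemma fsat_shift: "fsat c (\<lambda>k. w (k + d)) i f \<longleftrightarrow> fsat c w (i + d) f"
proof (induction f arbitrary: i)
  case (Unt f g)
  show ?case
  proof
    assume "fsat c (\<lambda>k. w (k + d)) i (Unt f g)"
    then obtain j where "j \<ge> i" "fsat c w (j + d) g" "\<forall>k. i \<le> k \<and> k < j \<longrightarrow> fsat c w (k + d) f"
      by (auto simp: Unt.IH)
    moreover have "fsat c w k f" if "i + d \<le> k" "k < j + d" for k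
      using calculation(3)[rule_format, of "k - d"] that by (simp add: le_diff_conv2 less_diff_conv2)
    ultimately show "fsat c w (i + d) (Unt f g)" by (auto intro!: exI[of _ "j + d"])
  next
    assume "fsat c w (i + d) (Unt f g)"
    then obtain j where "j \<ge> i + d" "fsat c w j g" "\<forall>k. i + d \<le> k \<and> k < j \<longrightarrow> fsat c w k f"
      by auto
    then show "fsat c (\<lambda>k. w (k + d)) i (Unt f g)"
      by (auto simp: Unt.IH intro!: exI[of _ "j - d"])
  qed
next
  case (Rel f g)
  show ?case
  proof
    assume *: "fsat c (\<lambda>k. w (k + d)) i (Rel f g)"
    have "fsat c w j g \<or> (\<exists>k. i + d \<le> k \<and> k < j \<and> fsat c w k f)" if "j \<ge> i + d" for j
    proof -
      from * that have "fsat c w j g \<or> (\<exists>k. i \<le> k \<and> k < j - d \<and> fsat c w (k + d) f)"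
        by (auto simp: Rel.IH dest!: spec[of _ "j - d"])
      then show ?thesis using that
        by (auto intro: exI[of _ "_ + d"])
    qed
    then show "fsat c w (i + d) (Rel f g)" by simp
  next
    assume *: "fsat c w (i + d) (Rel f g)"
    have "fsat c w (j + d) g \<or> (\<exists>k. i \<le> k \<and> k < j \<and> fsat c w (k + d) f)" if "j \<ge> i" for j
    proof -
      from * that have "fsat c w (j + d) g \<or> (\<exists>k. i + d \<le> k \<and> k < j + d \<and> fsat c w k f)"
        by (auto dest!: spec[of _ "j + d"])
      then show ?thesis
      proof
        assume "\<exists>k. i + d \<le> k \<and> k < j + d \<and> fsat c w k f"
        then obtain k where "i + d \<le> k" "k < j + d" "fsat c w k f" by blast
        then show ?thesis by (intro disjI2 exI[of _ "k - d"]) auto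
      qed simp
    qed
    then show "fsat c (\<lambda>k. w (k + d)) i (Rel f g)" by (simp add: Rel.IH)
  qed
next
  case (Ev f)
  show ?case
  proof
    assume "fsat c (\<lambda>k. w (k + d)) i (Ev f)"
    then obtain j where "i \<le> j" "j \<le> i + c" "fsat c w (j + d) f" by (auto simp: Ev.IH)
    then show "fsat c w (i + d) (Ev f)" by (auto intro!: exI[of _ "j + d"])
  next
    assume "fsat c w (i + d) (Ev f)"
    then obtain j where "i + d \<le> j" "j \<le> i + d + c" "fsat c w j f" by auto
    then show "fsat c (\<lambda>k. w (k + d)) i (Ev f)"
      by (auto simp: Ev.IH intro!: exI[of _ "j - d"])
  qed
next
  case (Alw f)
  show ?case
  proof
    assume *: "fsat c (\<lambda>k. w (k + d)) i (Alw f)"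
    have "fsat c w j f" if "i + d \<le> j" "j \<le> i + d + c" for j
      using * that by (auto simp: Alw.IH dest!: spec[of _ "j - d"])
    then show "fsat c w (i + d) (Alw f)" by simp
  next
    assume "fsat c w (i + d) (Alw f)"
    then show "fsat c (\<lambda>k. w (k + d)) i (Alw f)" by (auto simp: Alw.IH)
  qed
qed auto

text \<open>Evaluation under a label \<open>A\<close>: Boolean structure is computed, temporal
  formulas are looked up. Negation occurs only inside literals, so the result is monotone in
  \<open>A\<close>.\<close>

primrec loc :: "'s \<Rightarrow> 's fm set \<Rightarrow> 's fm \<Rightarrow> bool" where
  "loc s A (Lit P) \<longleftrightarrow> P s"
| "loc s A (Conj f g) \<longleftrightarrow> loc s A f \<and> loc s A g"
| "loc s A (Disj f g) \<longleftrightarrow> loc s A f \<or> loc s A g"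
| "loc s A (Nxt f) \<longleftrightarrow> Nxt f \<in> A"
| "loc s A (Unt f g) \<longleftrightarrow> Unt f g \<in> A"
| "loc s A (Rel f g) \<longleftrightarrow> Rel f g \<in> A"
| "loc s A (Ev f) \<longleftrightarrow> Ev f \<in> A"
| "loc s A (Alw f) \<longleftrightarrow> Alw f \<in> A"

lemma loc_mono: "loc s A f \<Longrightarrow> A \<subseteq> A' \<Longrightarrow> loc s A' f"
  by (induction f) auto

section \<open>Translation of pLTL formulas\<close>

primrec tr :: "('s \<Rightarrow> 'ap set) \<Rightarrow> ('ap, 'x) pltl \<Rightarrow> 's fm" where
  "tr L (Atom a) = Lit (\<lambda>s. a \<in> L s)"
| "tr L (NAtom a) = Lit (\<lambda>s. a \<notin> L s)"
| "tr L (And \<phi> \<psi>) = Conj (tr L \<phi>) (tr L \<psi>)"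
| "tr L (Or \<phi> \<psi>) = Disj (tr L \<phi>) (tr L \<psi>)"
| "tr L (Next \<phi>) = Nxt (tr L \<phi>)"
| "tr L (Until \<phi> \<psi>) = Unt (tr L \<phi>) (tr L \<psi>)"
| "tr L (Release \<phi> \<psi>) = Rel (tr L \<phi>) (tr L \<psi>)"
| "tr L (Always \<phi>) = Rel (Lit (\<lambda>_. False)) (tr L \<phi>)"
| "tr L (EventuallyVar x \<phi>) = Ev (tr L \<phi>)"
| "tr L (EventuallyConst c \<phi>) = ((\<lambda>g. Disj (tr L \<phi>) (Nxt g)) ^^ c) (tr L \<phi>)"
| "tr L (AlwaysConst c \<phi>) = ((\<lambda>g. Conj (tr L \<phi>) (Nxt g)) ^^ c) (tr L \<phi>)"

lemma ex_interval_Suc: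
  "(\<exists>j. i \<le> j \<and> j \<le> i + Suc c \<and> P j) \<longleftrightarrow> P i \<or> (\<exists>j. Suc i \<le> j \<and> j \<le> Suc i + c \<and> P j)"
  by (metis Suc_leI add_Suc add_Suc_right le_add1 le_neq_implies_less le_refl less_imp_le_nat
      less_eq_Suc_le)

lemma all_interval_Suc:
  "(\<forall>j. i \<le> j \<and> j \<le> i + Suc c \<longrightarrow> P j) \<longleftrightarrow> P i \<and> (\<forall>j. Suc i \<le> j \<and> j \<le> Suc i + c \<longrightarrow> P j)"
  using ex_interval_Suc[of i c "\<lambda>j. \<not> P j"] by blast

lemma fsat_tr: "fsat c w i (tr L \<phi>) \<longleftrightarrow> sat (\<lambda>k. L (w k)) i (\<lambda>_. c) \<phi>"
proof (induction \<phi> arbitrary: i)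
  case (EventuallyConst d \<phi>)
  show ?case
  proof (induction d arbitrary: i)
    case 0
    then show ?case using EventuallyConst by (auto simp: le_antisym dest: le_antisym)
  next
    case (Suc d)
    then show ?case using EventuallyConst
      unfolding sat.simps ex_interval_Suc by simp
  qed
next
  case (AlwaysConst d \<phi>)
  show ?case
  proof (induction d arbitrary: i)
    case 0
    then show ?case using AlwaysConst by (auto simp: le_antisym dest: le_antisym)
  next
    case (Suc d)
    then show ?case using AlwaysConst
      unfolding sat.simps all_interval_Suc by simp
  qed
qed auto

text \<open>Variables bound only eventualities, so larger values help. Hence any valuation may be
  replaced by a constant one, which is why \<open>tr\<close> can forget the variable names. Only
  occurring variables are compared, so a maximum over a finite set suffices.\<close>

lemma sat_mono:
  "sat w i v \<phi> \<Longrightarrow> \<forall>x\<in>set2_pltl \<phi>. v x \<le> v' x \<Longrightarrow> sat w i v' \<phi>"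
proof (induction \<phi> arbitrary: i)
  case (EventuallyVar x \<phi>)
  then obtain j where "i \<le> j" "j \<le> i + v x" "sat w j v \<phi>" by auto
  moreover have "v x \<le> v' x" using EventuallyVar by auto
  ultimately show ?case using EventuallyVar by (auto intro!: exI[of _ j])
qed (auto; metis)+

text \<open>Each operator contributes at most one temporal subformula and each unit of a constant
  bound one \<open>Nxt\<close>, matching the unary length; atoms give strictness.\<close>

lemma card_tsub_tr: "card (tsub (tr L \<phi>)) < len \<phi>"
proof (induction \<phi>)
  case (And \<phi> \<psi>)
  then show ?case using card_Un_le[of "tsub (tr L \<phi>)" "tsub (tr L \<psi>)"] by simp
next
  case (Or \<phi> \<psi>)
  then show ?case using card_Un_le[of "tsub (tr L \<phi>)" "tsub (tr L \<psi>)"] by simp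
next
  case (Until \<phi> \<psi>)
  then show ?case using card_Un_le[of "tsub (tr L \<phi>)" "tsub (tr L \<psi>)"]
    by (simp add: card_insert_if)
next
  case (Release \<phi> \<psi>)
  then show ?case using card_Un_le[of "tsub (tr L \<phi>)" "tsub (tr L \<psi>)"]
    by (simp add: card_insert_if)
next
  case (EventuallyConst c \<phi>)
  let ?g = "\<lambda>d. ((\<lambda>g. Disj (tr L \<phi>) (Nxt g)) ^^ d) (tr L \<phi>)"
  \<comment> \<open>The inclusion ensures that an unfolding adds at most the formula
    \<open>Nxt (?g d)\<close>: the repeated copy of the argument is already counted.\<close>
  have "tsub (tr L \<phi>) \<subseteq> tsub (?g d) \<and> card (tsub (?g d)) \<le> d + card (tsub (tr L \<phi>))" for d
  proof (induction d)
    case (Suc d)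
    then have "tsub (?g (Suc d)) = insert (Nxt (?g d)) (tsub (?g d))" by auto
    then show ?case using Suc by (auto simp: card_insert_if simp del: funpow.simps)
  qed simp
  from this[of c] show ?case using EventuallyConst by simp
next
  case (AlwaysConst c \<phi>)
  let ?g = "\<lambda>d. ((\<lambda>g. Conj (tr L \<phi>) (Nxt g)) ^^ d) (tr L \<phi>)"
  have "tsub (tr L \<phi>) \<subseteq> tsub (?g d) \<and> card (tsub (?g d)) \<le> d + card (tsub (tr L \<phi>))" for d
  proof (induction d)
    case (Suc d)
    then have "tsub (?g (Suc d)) = insert (Nxt (?g d)) (tsub (?g d))" by auto
    then show ?case using Suc by (auto simp: card_insert_if simp del: funpow.simps)
  qed simp
  from this[of c] show ?case using AlwaysConst by simp
qed (simp_all add: card_insert_if)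

lemma Alw_notin_tsub_tr: "Alw h \<notin> tsub (tr L \<phi>)"
proof (induction \<phi>)
  case (EventuallyConst c \<phi>)
  have "Alw h \<notin> tsub (((\<lambda>g. Disj (tr L \<phi>) (Nxt g)) ^^ d) (tr L \<phi>))" for d
    using EventuallyConst by (induction d) auto
  then show ?case by simp
next
  case (AlwaysConst c \<phi>)
  have "Alw h \<notin> tsub (((\<lambda>g. Conj (tr L \<phi>) (Nxt g)) ^^ d) (tr L \<phi>))" for d
    using AlwaysConst by (induction d) auto
  then show ?case by simp
qed auto

section \<open>Words that are generic for a bottom component\<close>

locale bottom =
  fixes S :: "'s set" and E :: "'s \<Rightarrow> 's \<Rightarrow> bool" and B :: "'s set"
  assumes finite_S: "finite S"
    and closed: "\<And>s t. s \<in> B \<Longrightarrow> E s t \<Longrightarrow> t \<in> B"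
begin

text \<open>A deterministic stand-in for a typical path of the chain that ends up in
  \<open>B\<close>, so that the arguments about formulas are free of probability.\<close>

definition gen :: "(nat \<Rightarrow> 's) \<Rightarrow> bool" where
  "gen w \<longleftrightarrow> (\<forall>k. w k \<in> S \<and> E (w k) (w (Suc k))) \<and> (\<exists>k. w k \<in> B) \<and>
     (\<forall>\<pi> n. \<pi> 0 \<in> B \<and> (\<forall>k<n. E (\<pi> k) (\<pi> (Suc k))) \<longrightarrow>
        (\<exists>\<^sub>\<infinity>i. \<forall>k\<le>n. w (i + k) = \<pi> k))"

lemma gen_in: "gen w \<Longrightarrow> w k \<in> S"
  and gen_edge: "gen w \<Longrightarrow> E (w k) (w (Suc k))"
  and gen_reaches: "gen w \<Longrightarrow> \<exists>k. w k \<in> B"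
  and gen_recurrent: "gen w \<Longrightarrow> \<pi> 0 \<in> B \<Longrightarrow> (\<And>k. k < n \<Longrightarrow> E (\<pi> k) (\<pi> (Suc k))) \<Longrightarrow>
        \<exists>\<^sub>\<infinity>i. \<forall>k\<le>n. w (i + k) = \<pi> k"
  unfolding gen_def by blast+

lemma gen_stays:
  assumes "gen w" "w k \<in> B" "k \<le> j"
  shows "w j \<in> B"
  using \<open>k \<le> j\<close>
  by (induction rule: dec_induct) (use assms closed gen_edge in blast)+

lemma gen_reaches_after: "gen w \<Longrightarrow> \<exists>k\<ge>i. w k \<in> B"
  by (metis gen_reaches gen_stays nat_le_linear)

text \<open>Recurrence and reaching \<open>B\<close> are properties of a tail, so splicing along
  edges preserves genericity. This covers shifting, cutting and pumping.\<close>

lemma gen_tail: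
  assumes "gen w" and "\<And>k. w' k \<in> S \<and> E (w' k) (w' (Suc k))"
    and tail: "\<And>k. w' (k + a) = w (k + b)"
  shows "gen w'"
  unfolding gen_def
proof (intro conjI allI impI)
  obtain k where "k \<ge> b" "w k \<in> B" using gen_reaches_after[OF \<open>gen w\<close>] by blast
  then have "w' (k - b + a) \<in> B" using tail[of "k - b"] by simp
  then show "\<exists>k. w' k \<in> B" ..
next
  fix \<pi> n
  assume "\<pi> 0 \<in> B \<and> (\<forall>k<n. E (\<pi> k) (\<pi> (Suc k)))"
  then have inf: "\<exists>\<^sub>\<infinity>i. \<forall>k\<le>n. w (i + k) = \<pi> k" using gen_recurrent[OF \<open>gen w\<close>, of \<pi> n] by blast
  show "\<exists>\<^sub>\<infinity>i. \<forall>k\<le>n. w' (i + k) = \<pi> k"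
    unfolding INFM_nat_le
  proof
    fix m
    from inf obtain i where i: "i \<ge> m + b" "\<forall>k\<le>n. w (i + k) = \<pi> k"
      unfolding INFM_nat_le by blast
    have "w' (i - b + a + k) = \<pi> k" if "k \<le> n" for k
      using tail[of "i - b + k"] i that by (simp add: algebra_simps)
    then show "\<exists>i\<ge>m. \<forall>k\<le>n. w' (i + k) = \<pi> k" using i by (intro exI[of _ "i - b + a"]) auto
  qed
qed (use assms in auto)

lemma gen_shift: "gen w \<Longrightarrow> gen (\<lambda>k. w (k + d))"
  by (rule gen_tail[where a = 0 and b = d and w = w]) (auto simp: gen_in gen_edge)

text \<open>Stands for almost sure truth in \<open>B\<close>. Since shifts of generic words are
  generic, position \<open>0\<close> represents every position in \<open>B\<close>.\<close>

definition surely :: "nat \<Rightarrow> 's fm set" where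
  "surely c = {g. \<forall>w. gen w \<and> w 0 \<in> B \<longrightarrow> fsat c w 0 g}"

lemma surelyD: "g \<in> surely c \<Longrightarrow> gen w \<Longrightarrow> w k \<in> B \<Longrightarrow> fsat c w k g"
  using gen_shift[of w k] fsat_shift[of c w k 0 g] unfolding surely_def by auto

text \<open>Local constancy: in the prefix topology on generic words, the models of \<open>f\<close>
  at each position form a set that is both open and closed.\<close>

definition determined :: "nat \<Rightarrow> 's fm \<Rightarrow> bool" where
  "determined c f \<longleftrightarrow> (\<forall>w i. gen w \<longrightarrow> (\<exists>n. \<forall>w'. gen w' \<and> (\<forall>k\<le>n. w' k = w k) \<longrightarrow>
     fsat c w' i f = fsat c w i f))"

lemma determinedE:
  assumes "determined c f" "gen w"
  obtains n where "\<And>w'. gen w' \<Longrightarrow> (\<And>k. k \<le> n \<Longrightarrow> w' k = w k) \<Longrightarrow> fsat c w' i f = fsat c w i f"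
  using assms unfolding determined_def by metis

lemma determined_range:
  assumes "determined c f" "gen w"
  shows "\<exists>n. \<forall>w'. gen w' \<and> (\<forall>k\<le>n. w' k = w k) \<longrightarrow> (\<forall>i<j. fsat c w' i f = fsat c w i f)"
proof (induction j)
  case (Suc j)
  then obtain n where n: "\<forall>w'. gen w' \<and> (\<forall>k\<le>n. w' k = w k) \<longrightarrow> (\<forall>i<j. fsat c w' i f = fsat c w i f)"
    by blast
  obtain n' where n': "\<And>w'. gen w' \<Longrightarrow> (\<And>k. k \<le> n' \<Longrightarrow> w' k = w k) \<Longrightarrow> fsat c w' j f = fsat c w j f"
    using determinedE[OF assms] by blast
  show ?case
  proof (rule exI[of _ "max n n'"], intro allI impI)
    fix w' i assume "gen w' \<and> (\<forall>k\<le>max n n'. w' k = w k)" "i < Suc j"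
    then show "fsat c w' i f = fsat c w i f" using n n' by (cases "i = j") auto
  qed
qed simp

lemma determined_neg: "determined c (neg f) = determined c f"
  unfolding determined_def by simp

text \<open>A counterexample starting in \<open>B\<close> is decided by a finite prefix, and that
  prefix is a path of \<open>B\<close>, so it recurs in every generic word.\<close>

lemma recurrent_fails:
  assumes "determined c g" "gen w" "g \<notin> surely c"
  shows "\<exists>\<^sub>\<infinity>i. \<not> fsat c w i g"
proof -
  obtain w1 where w1: "gen w1" "w1 0 \<in> B" "\<not> fsat c w1 0 g"
    using assms(3) unfolding surely_def by blast
  obtain n where n: "\<And>w'. gen w' \<Longrightarrow> (\<And>k. k \<le> n \<Longrightarrow> w' k = w1 k) \<Longrightarrow> fsat c w' 0 g = fsat c w1 0 g"
    using determinedE[OF assms(1) w1(1)] by blast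
  have "\<exists>\<^sub>\<infinity>i. \<forall>k\<le>n. w (i + k) = w1 k"
    using gen_recurrent[of w w1 n] assms(2) w1 gen_edge by blast
  then show ?thesis
  proof (rule INFM_mono)
    fix i assume "\<forall>k\<le>n. w (i + k) = w1 k"
    then have "fsat c (\<lambda>k. w (k + i)) 0 g = fsat c w1 0 g"
      by (intro n gen_shift assms) (simp add: add.commute)
    then show "\<not> fsat c w i g" using w1 fsat_shift[of c w i 0 g] by simp
  qed
qed

text \<open>
  An until that is neither fulfilled nor violated at a finite position has a second argument that
  fails forever, hence, by recurrence, surely in the bottom component.
\<close>

lemma determined_Unt:
  assumes "determined c f" "determined c g"
  shows "determined c (Unt f g)"
  unfolding determined_def
proof (intro allI impI)
  fix w i assume w: "gen w"
  \<comment> \<open>A \<open>stop\<close> settles an until that is still open: \<open>g\<close>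
    fulfils it or the failure of \<open>f\<close> violates it.\<close>
  define stop where "stop j \<longleftrightarrow> i \<le> j \<and> (fsat c w j g \<or> \<not> fsat c w j f)" for j
  obtain b where b: "b \<ge> i" "w b \<in> B" using gen_reaches_after[OF w] by blast
  obtain j0 where j0: "j0 \<ge> i" "stop j0 \<or> neg g \<in> surely c \<and> w j0 \<in> B"
  proof (cases "\<exists>j. stop j")
    case False
    have "neg g \<in> surely c"
    proof (rule ccontr)
      assume "neg g \<notin> surely c"
      from recurrent_fails[OF _ w this] assms(2) have "\<exists>\<^sub>\<infinity>i. fsat c w i g"
        by (simp add: determined_neg)
      then show False using False unfolding INFM_nat_le stop_def by blast
    qed
    then show thesis using that[of b] b by blast
  qed (use that stop_def in blast)
  obtain n1 where n1: "\<forall>w'. gen w' \<and> (\<forall>k\<le>n1. w' k = w k) \<longrightarrow> (\<forall>i<Suc j0. fsat c w' i f = fsat c w i f)"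
    using determined_range[OF assms(1) w] by blast
  obtain n2 where n2: "\<forall>w'. gen w' \<and> (\<forall>k\<le>n2. w' k = w k) \<longrightarrow> (\<forall>i<Suc j0. fsat c w' i g = fsat c w i g)"
    using determined_range[OF assms(2) w] by blast
  show "\<exists>n. \<forall>w'. gen w' \<and> (\<forall>k\<le>n. w' k = w k) \<longrightarrow> fsat c w' i (Unt f g) = fsat c w i (Unt f g)"
  proof (rule exI[of _ "max j0 (max n1 n2)"], intro allI impI)
    fix w' assume w': "gen w' \<and> (\<forall>k\<le>max j0 (max n1 n2). w' k = w k)"
    \<comment> \<open>A witness beyond \<open>j0\<close> is impossible if \<open>neg g\<close> is
      sure from there. If \<open>j0\<close> is a stop, then \<open>f\<close> at \<open>j0\<close>
      forces \<open>g\<close> at \<open>j0\<close>, which is itself a witness.\<close>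
    have cut: "fsat c u i (Unt f g) \<longleftrightarrow>
        (\<exists>j. i \<le> j \<and> j \<le> j0 \<and> fsat c u j g \<and> (\<forall>k. i \<le> k \<and> k < j \<longrightarrow> fsat c u k f))"
      if u: "gen u" "u j0 = w j0" and agree: "fsat c u j0 f = fsat c w j0 f" "fsat c u j0 g = fsat c w j0 g"
      for u
    proof
      assume "fsat c u i (Unt f g)"
      then obtain j where j: "j \<ge> i" "fsat c u j g" "\<forall>k. i \<le> k \<and> k < j \<longrightarrow> fsat c u k f"
        by auto
      show "\<exists>j. i \<le> j \<and> j \<le> j0 \<and> fsat c u j g \<and> (\<forall>k. i \<le> k \<and> k < j \<longrightarrow> fsat c u k f)"
      proof (cases "j \<le> j0")
        case False
        then have "fsat c u j0 f" using j j0 by auto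
        moreover have "\<not> (neg g \<in> surely c \<and> w j0 \<in> B)"
          using surelyD[of "neg g" c u j] gen_stays[of u j0 j] False u j(2) by auto
        ultimately have "fsat c u j0 g" using j0 agree unfolding stop_def by blast
        then show ?thesis using j j0 False by (intro exI[of _ j0]) auto
      qed (use j in blast)
    qed auto
    have agree: "fsat c w' j f = fsat c w j f" "fsat c w' j g = fsat c w j g" if "j \<le> j0" for j
      using n1 n2 w' that by auto
    have "fsat c w' i (Unt f g) \<longleftrightarrow>
        (\<exists>j. i \<le> j \<and> j \<le> j0 \<and> fsat c w' j g \<and> (\<forall>k. i \<le> k \<and> k < j \<longrightarrow> fsat c w' k f))"
      using w' agree by (intro cut) auto
    also have "\<dots> \<longleftrightarrow>
        (\<exists>j. i \<le> j \<and> j \<le> j0 \<and> fsat c w j g \<and> (\<forall>k. i \<le> k \<and> k < j \<longrightarrow> fsat c w k f))"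
      using agree by (intro ex_cong1 conj_cong refl all_cong1 imp_cong) auto
    also have "\<dots> \<longleftrightarrow> fsat c w i (Unt f g)"
      using cut[OF w refl refl refl] by blast
    finally show "fsat c w' i (Unt f g) = fsat c w i (Unt f g)" .
  qed
qed

lemma determined_Ev:
  assumes "determined c f"
  shows "determined c (Ev f)"
  unfolding determined_def
proof (intro allI impI)
  fix w i assume w: "gen w"
  obtain n where n: "\<forall>w'. gen w' \<and> (\<forall>k\<le>n. w' k = w k) \<longrightarrow> (\<forall>j<Suc (i + c). fsat c w' j f = fsat c w j f)"
    using determined_range[OF assms w] by blast
  then have "\<forall>w'. gen w' \<and> (\<forall>k\<le>n. w' k = w k) \<longrightarrow> fsat c w' i (Ev f) = fsat c w i (Ev f)"
    by (metis fsat.simps(7) le_imp_less_Suc)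
  then show "\<exists>n. \<forall>w'. gen w' \<and> (\<forall>k\<le>n. w' k = w k) \<longrightarrow> fsat c w' i (Ev f) = fsat c w i (Ev f)"
    by blast
qed

lemma determined_Disj:
  assumes "determined c f" "determined c g"
  shows "determined c (Disj f g)"
  unfolding determined_def
proof (intro allI impI)
  fix w i assume w: "gen w"
  obtain n where n: "\<And>w'. gen w' \<Longrightarrow> (\<And>k. k \<le> n \<Longrightarrow> w' k = w k) \<Longrightarrow> fsat c w' i f = fsat c w i f"
    using determinedE[OF assms(1) w] by blast
  obtain n' where n': "\<And>w'. gen w' \<Longrightarrow> (\<And>k. k \<le> n' \<Longrightarrow> w' k = w k) \<Longrightarrow> fsat c w' i g = fsat c w i g"
    using determinedE[OF assms(2) w] by blast
  show "\<exists>n. \<forall>w'. gen w' \<and> (\<forall>k\<le>n. w' k = w k) \<longrightarrow> fsat c w' i (Disj f g) = fsat c w i (Disj f g)"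
    by (rule exI[of _ "max n n'"]) (auto simp: n n')
qed

lemma determined: "determined c f"
proof (induction f)
  case (Lit P)
  show ?case
    unfolding determined_def
  proof (intro allI impI)
    fix w i
    show "\<exists>n. \<forall>w'. gen w' \<and> (\<forall>k\<le>n. w' k = w k) \<longrightarrow> fsat c w' i (Lit P) = fsat c w i (Lit P)"
      by (rule exI[of _ i]) auto
  qed
next
  case (Conj f g)
  then have "determined c (neg (Disj (neg f) (neg g)))"
    unfolding determined_neg by (intro determined_Disj) (auto simp: determined_neg)
  then show ?case by simp
next
  case (Rel f g)
  then have "determined c (neg (Unt (neg f) (neg g)))"
    unfolding determined_neg by (intro determined_Unt) (auto simp: determined_neg)
  then show ?case by simp
next
  case (Alw f)
  then have "determined c (neg (Ev (neg f)))"
    unfolding determined_neg by (intro determined_Ev) (auto simp: determined_neg)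
  then show ?case by simp
next
  case (Nxt f)
  then show ?case by (simp add: determined_def)
qed (auto intro: determined_Disj determined_Unt determined_Ev)

section \<open>Finite certificates\<close>

text \<open>One-step expansion laws. Postponing \<open>Unt\<close> or \<open>Ev\<close> forever is
  excluded not here but by the empty labels at the end of a certificate. The obligation of
  \<open>Alw\<close> is tracked by \<open>D\<close> instead.\<close>

primrec just :: "'s fm set \<Rightarrow> 's \<Rightarrow> 's fm set \<Rightarrow> 's \<Rightarrow> 's fm set \<Rightarrow> 's fm \<Rightarrow> bool" where
  "just T s A s' A' (Lit P) \<longleftrightarrow> False"
| "just T s A s' A' (Conj f g) \<longleftrightarrow> False"
| "just T s A s' A' (Disj f g) \<longleftrightarrow> False"
| "just T s A s' A' (Nxt f) \<longleftrightarrow> loc s' A' f"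
| "just T s A s' A' (Unt f g) \<longleftrightarrow> loc s A g \<or> loc s A f \<and> Unt f g \<in> A'"
| "just T s A s' A' (Rel f g) \<longleftrightarrow>
     s \<in> B \<and> g \<in> T \<or> loc s A g \<and> (loc s A f \<or> Rel f g \<in> A')"
| "just T s A s' A' (Ev f) \<longleftrightarrow> loc s A f \<or> Ev f \<in> A'"
| "just T s A s' A' (Alw f) \<longleftrightarrow> True"

lemma just_mono:
  "just T s A s' A' h \<Longrightarrow> A \<subseteq> C \<Longrightarrow> A' \<subseteq> C' \<Longrightarrow> just T s C s' C' h"
  by (cases h) (auto dest: loc_mono)

text \<open>
  \<open>A k\<close> holds the temporal formulas claimed at position \<open>k\<close> and \<open>D k\<close> the arguments of claimed
  \<open>Alw\<close>-formulas that are still to be maintained. A claim \<open>Alw f\<close> keeps \<open>f\<close> in \<open>D\<close> for \<open>u\<close> further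
  steps; \<open>f\<close> leaves \<open>D\<close> only after having been there for at least \<open>b\<close> steps. Both bounds start out
  equal, then \<open>u\<close> is raised while \<open>b\<close> stays fixed. \<open>Ev\<close>-claims carry no bound: the number \<open>n\<close> of
  positions with claims bounds the delay. \<open>T\<close> contains the formulas that hold surely in \<open>B\<close>; it is
  what allows a release that is never triggered to be discharged at a finite position.
\<close>

definition cert :: "'s fm set \<Rightarrow> nat \<Rightarrow> nat \<Rightarrow> 's fm set \<Rightarrow> (nat \<Rightarrow> 's) \<Rightarrow>
    (nat \<Rightarrow> 's fm set) \<Rightarrow> (nat \<Rightarrow> 's fm set) \<Rightarrow> nat \<Rightarrow> bool" where
  "cert T b u X w A D n \<longleftrightarrow>
     (\<forall>k. A k \<subseteq> X \<and> Alw ` D k \<subseteq> X) \<and>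
     (\<forall>k\<ge>n. A k = {} \<and> D k = {}) \<and>
     (\<forall>k. \<forall>h\<in>A k. just T (w k) (A k) (w (Suc k)) (A (Suc k)) h) \<and>
     (\<forall>k f. Alw f \<in> A k \<longrightarrow> (\<forall>j\<le>u. f \<in> D (k + j))) \<and>
     (\<forall>k. \<forall>f\<in>D k. loc (w k) (A k) f) \<and>
     (\<forall>k f. f \<in> D k \<longrightarrow> f \<notin> D (Suc k) \<longrightarrow> b \<le> k \<and> (\<forall>j\<le>b. f \<in> D (k - j)))"

context
  fixes T b u X w A D n
  assumes C: "cert T b u X w A D n"
begin

lemma cert_subset: "h \<in> A k \<Longrightarrow> h \<in> X"
  and cert_subset_D: "f \<in> D k \<Longrightarrow> Alw f \<in> X"
  using C[unfolded cert_def, THEN conjunct1] by blast+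

lemma cert_end: "n \<le> k \<Longrightarrow> A k = {}"
  and cert_end_D: "n \<le> k \<Longrightarrow> D k = {}"
  using C[unfolded cert_def, THEN conjunct2, THEN conjunct1] by blast+

lemma cert_just: "h \<in> A k \<Longrightarrow> just T (w k) (A k) (w (Suc k)) (A (Suc k)) h"
  using C[unfolded cert_def, THEN conjunct2, THEN conjunct2, THEN conjunct1] by blast

lemma cert_Alw: "Alw f \<in> A k \<Longrightarrow> j \<le> u \<Longrightarrow> f \<in> D (k + j)"
  using C[unfolded cert_def, THEN conjunct2, THEN conjunct2, THEN conjunct2, THEN conjunct1] by blast

lemma cert_D: "f \<in> D k \<Longrightarrow> loc (w k) (A k) f"
  and cert_exit: "f \<in> D k \<Longrightarrow> f \<notin> D (Suc k) \<Longrightarrow> b \<le> k \<and> (\<forall>j\<le>b. f \<in> D (k - j))"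
  using C[unfolded cert_def, THEN conjunct2, THEN conjunct2, THEN conjunct2, THEN conjunct2]
  by blast+

end

text \<open>The added claims may rely on the labels \<open>A1\<close>, so one claim can be laid over
  certificates for its arguments.\<close>

lemma cert_Un_gen:
  assumes C: "cert T b u X w A1 D1 n1"
    and "\<And>k h. h \<in> A2 k \<Longrightarrow> h \<in> X" "\<And>k f. f \<in> D2 k \<Longrightarrow> Alw f \<in> X"
    and "\<And>k. n2 \<le> k \<Longrightarrow> A2 k = {}" "\<And>k. n2 \<le> k \<Longrightarrow> D2 k = {}"
    and "\<And>k h. h \<in> A2 k \<Longrightarrow> just T (w k) (A1 k \<union> A2 k) (w (Suc k)) (A1 (Suc k) \<union> A2 (Suc k)) h"
    and "\<And>k f j. Alw f \<in> A2 k \<Longrightarrow> j \<le> u \<Longrightarrow> f \<in> D2 (k + j)"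
    and "\<And>k f. f \<in> D2 k \<Longrightarrow> loc (w k) (A1 k \<union> A2 k) f"
    and "\<And>k f. f \<in> D2 k \<Longrightarrow> f \<notin> D2 (Suc k) \<Longrightarrow> b \<le> k \<and> (\<forall>j\<le>b. f \<in> D2 (k - j))"
  shows "cert T b u X w (\<lambda>k. A1 k \<union> A2 k) (\<lambda>k. D1 k \<union> D2 k) (max n1 n2)"
  unfolding cert_def
proof (intro conjI allI impI ballI)
  fix k h assume "h \<in> A1 k \<union> A2 k"
  then show "just T (w k) (A1 k \<union> A2 k) (w (Suc k)) (A1 (Suc k) \<union> A2 (Suc k)) h"
    using assms(6) cert_just[OF C] just_mono by (metis Un_iff sup_ge1)
next
  fix k f assume "f \<in> D1 k \<union> D2 k"
  then show "loc (w k) (A1 k \<union> A2 k) f"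
    using assms(8) cert_D[OF C] loc_mono by (metis Un_iff sup_ge1)
next
  fix k f assume *: "f \<in> D1 k \<union> D2 k" "f \<notin> D1 (Suc k) \<union> D2 (Suc k)"
  show "b \<le> k" using * assms(9) cert_exit[OF C] by blast
  fix j assume "j \<le> b"
  then show "f \<in> D1 (k - j) \<union> D2 (k - j)" using * assms(9) cert_exit[OF C] by blast
qed (use assms cert_subset[OF C] cert_subset_D[OF C] cert_end[OF C] cert_end_D[OF C] cert_Alw[OF C] in auto)

lemma cert_Un:
  assumes "cert T b u X w A1 D1 n1" and C2: "cert T b u X w A2 D2 n2"
  shows "cert T b u X w (\<lambda>k. A1 k \<union> A2 k) (\<lambda>k. D1 k \<union> D2 k) (max n1 n2)"
proof (rule cert_Un_gen[OF assms(1)])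
  fix k h assume "h \<in> A2 k"
  then show "just T (w k) (A1 k \<union> A2 k) (w (Suc k)) (A1 (Suc k) \<union> A2 (Suc k)) h"
    using cert_just[OF C2] just_mono by (metis sup_ge2)
next
  fix k f assume "f \<in> D2 k"
  then show "loc (w k) (A1 k \<union> A2 k) f"
    using cert_D[OF C2] loc_mono by (metis sup_ge2)
qed (use cert_subset[OF C2] cert_subset_D[OF C2] cert_end[OF C2] cert_end_D[OF C2] cert_Alw[OF C2]
      cert_exit[OF C2] in auto)

lemma cert_empty: "cert T b u X w (\<lambda>_. {}) (\<lambda>_. {}) 0"
  unfolding cert_def by simp

definition certified where
  "certified T b u X w k f \<longleftrightarrow> (\<exists>A D n. cert T b u X w A D n \<and> loc (w k) (A k) f)"

lemma certified_finite:
  assumes "finite P" and "\<And>k f. (k, f) \<in> P \<Longrightarrow> certified T b u X w k f"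
  shows "\<exists>A D n. cert T b u X w A D n \<and> (\<forall>(k, f)\<in>P. loc (w k) (A k) f)"
  using assms
proof (induction P)
  case empty
  then show ?case using cert_empty by blast
next
  case (insert p P)
  obtain k0 f0 where p: "p = (k0, f0)" by fastforce
  from insert obtain A1 D1 n1 where 1: "cert T b u X w A1 D1 n1" "\<forall>(k, f)\<in>P. loc (w k) (A1 k) f"
    by auto
  from insert.prems[of k0 f0] p obtain A2 D2 n2 where 2: "cert T b u X w A2 D2 n2" "loc (w k0) (A2 k0) f0"
    unfolding certified_def by blast
  have "\<forall>(k, f)\<in>insert p P. loc (w k) (A1 k \<union> A2 k) f"
    using 1(2) 2(2) p by (auto intro: loc_mono)
  then show ?case using cert_Un[OF 1(1) 2(1)] by blast
qed

text \<open>Common pattern of \<open>Nxt\<close>, \<open>Unt\<close>, \<open>Rel\<close> and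
  \<open>Ev\<close>: the claim \<open>h\<close> is handed on from \<open>i\<close> to
  \<open>m\<close> and discharged at \<open>m\<close> by the labels \<open>A\<close> alone.\<close>

lemma certified_claim:
  assumes C: "cert T b u X w A D n" and "h \<in> X" "i \<le> m" "\<And>f. h \<noteq> Alw f"
    and "\<And>k A'. i \<le> k \<Longrightarrow> k < m \<Longrightarrow> h \<in> A' \<Longrightarrow> just T (w k) (A k) (w (Suc k)) A' h"
    and "\<And>A'. just T (w m) (A m) (w (Suc m)) (A (Suc m)) h"
  shows "certified T b u X w i h"
proof -
  let ?A = "\<lambda>k. if i \<le> k \<and> k \<le> m then {h} else {}"
  have "cert T b u X w (\<lambda>k. A k \<union> ?A k) (\<lambda>k. D k \<union> {}) (max n (Suc m))"
  proof (rule cert_Un_gen[OF C])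
    fix k g assume g: "g \<in> ?A k"
    show "just T (w k) (A k \<union> ?A k) (w (Suc k)) (A (Suc k) \<union> ?A (Suc k)) g"
    proof (cases "k = m")
      case True
      have "just T (w k) (A k) (w (Suc k)) (A (Suc k)) h" using assms(6) True by simp
      then show ?thesis using g by (auto intro: just_mono split: if_splits)
    next
      case False
      then have "just T (w k) (A k) (w (Suc k)) (A (Suc k) \<union> ?A (Suc k)) h"
        using g by (intro assms(5)) (auto split: if_splits)
      then show ?thesis using g by (auto intro: just_mono split: if_splits)
    qed
  qed (use assms in \<open>auto split: if_splits\<close>)
  moreover have "loc (w i) (A i \<union> ?A i) h"
  proof -
    have "just T (w m) (A m) (w (Suc m)) (A (Suc m)) h" by (rule assms(6))
    then show ?thesis using \<open>i \<le> m\<close> by (cases h) auto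
  qed
  ultimately show ?thesis unfolding certified_def by blast
qed

text \<open>Completeness of certificates, by induction on \<open>f\<close>: each operator reduces to
  finitely many obligations on its arguments, whose certificates are united.\<close>

lemma certified_fsat:
  assumes w: "gen w"
  shows "fsat c w i f \<Longrightarrow> tsub f \<subseteq> X \<Longrightarrow> certified (surely c) c c X w i f"
proof (induction f arbitrary: i)
  case (Lit P)
  then have "loc (w i) {} (Lit P)" by simp
  then show ?case unfolding certified_def using cert_empty by blast
next
  case (Conj f g)
  obtain A1 D1 n1 where 1: "cert (surely c) c c X w A1 D1 n1" "loc (w i) (A1 i) f"
    using Conj.IH(1)[of i] Conj.prems unfolding certified_def fsat.simps tsub.simps Un_subset_iff by blast
  obtain A2 D2 n2 where 2: "cert (surely c) c c X w A2 D2 n2" "loc (w i) (A2 i) g"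
    using Conj.IH(2)[of i] Conj.prems unfolding certified_def fsat.simps tsub.simps Un_subset_iff by blast
  have "loc (w i) (A1 i \<union> A2 i) (Conj f g)"
    using loc_mono[OF 1(2)] loc_mono[OF 2(2)] by simp
  with cert_Un[OF 1(1) 2(1)] show ?case unfolding certified_def by blast
next
  case (Disj f g)
  then have "certified (surely c) c c X w i f \<or> certified (surely c) c c X w i g" by auto
  then show ?case unfolding certified_def loc.simps by blast
next
  case (Nxt f)
  then have "certified (surely c) c c X w (Suc i) f" by simp
  then obtain A D n where *: "cert (surely c) c c X w A D n" "loc (w (Suc i)) (A (Suc i)) f"
    unfolding certified_def by blast
  show ?case by (rule certified_claim[OF *(1), where m = i]) (use Nxt * in auto)
next
  case (Unt f g)
  then obtain j where j: "i \<le> j" "fsat c w j g" "\<forall>k. i \<le> k \<and> k < j \<longrightarrow> fsat c w k f" by auto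
  let ?P = "insert (j, g) ((\<lambda>k. (k, f)) ` {i..<j})"
  have "\<exists>A D n. cert (surely c) c c X w A D n \<and> (\<forall>(k, f)\<in>?P. loc (w k) (A k) f)"
    by (rule certified_finite) (use Unt j in auto)
  then obtain A D n where *: "cert (surely c) c c X w A D n" "\<forall>(k, f)\<in>?P. loc (w k) (A k) f"
    by blast
  show ?case by (rule certified_claim[OF *(1), where m = j]) (use Unt.prems j *(2) in auto)
next
  case (Rel f g)
  show ?case
  proof (cases "\<exists>j\<ge>i. fsat c w j f")
    case True
    \<comment> \<open>Before the first trigger only \<open>g\<close> can satisfy the release, so
      \<open>g\<close> holds up to and including \<open>j\<close>.\<close>
    define j where "j = (LEAST j. i \<le> j \<and> fsat c w j f)"
    have j: "i \<le> j" "fsat c w j f" using LeastI_ex[of "\<lambda>j. i \<le> j \<and> fsat c w j f"] True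
      unfolding j_def by blast+
    have less: "\<not> fsat c w k f" if "i \<le> k" "k < j" for k
      using not_less_Least[of k "\<lambda>j. i \<le> j \<and> fsat c w j f"] that unfolding j_def by blast
    have g: "fsat c w k g" if "i \<le> k" "k \<le> j" for k
    proof -
      have "fsat c w k g \<or> (\<exists>l. i \<le> l \<and> l < k \<and> fsat c w l f)"
        using Rel.prems(1) that by simp
      then show ?thesis using less that by (meson less_le_trans)
    qed
    let ?P = "insert (j, f) ((\<lambda>k. (k, g)) ` {i..j})"
    have "\<exists>A D n. cert (surely c) c c X w A D n \<and> (\<forall>(k, f)\<in>?P. loc (w k) (A k) f)"
      by (rule certified_finite) (use Rel j g in auto)
    then obtain A D n where *: "cert (surely c) c c X w A D n" "\<forall>(k, f)\<in>?P. loc (w k) (A k) f"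
      by blast
    show ?thesis by (rule certified_claim[OF *(1), where m = j]) (use Rel.prems j *(2) in auto)
  next
    case False
    then have g: "fsat c w k g" if "i \<le> k" for k
      using Rel.prems(1) that by auto
    have T: "g \<in> surely c"
    proof (rule ccontr)
      assume "g \<notin> surely c"
      from recurrent_fails[OF determined w this] show False
        using g unfolding INFM_nat_le by blast
    qed
    \<comment> \<open>In \<open>B\<close> the remaining obligation on \<open>g\<close> is covered by
      \<open>surely c\<close>, so the claim may end at \<open>m\<close>.\<close>
    obtain m where m: "m \<ge> i" "w m \<in> B" using gen_reaches_after[OF w] by blast
    let ?P = "(\<lambda>k. (k, g)) ` {i..m}"
    have "\<exists>A D n. cert (surely c) c c X w A D n \<and> (\<forall>(k, f)\<in>?P. loc (w k) (A k) f)"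
      by (rule certified_finite) (use Rel m g in auto)
    then obtain A D n where *: "cert (surely c) c c X w A D n" "\<forall>(k, f)\<in>?P. loc (w k) (A k) f"
      by blast
    show ?thesis by (rule certified_claim[OF *(1), where m = m]) (use Rel.prems m T *(2) in auto)
  qed
next
  case (Ev f)
  then obtain j where j: "i \<le> j" "fsat c w j f" by auto
  then have "certified (surely c) c c X w j f" using Ev by simp
  then obtain A D n where *: "cert (surely c) c c X w A D n" "loc (w j) (A j) f"
    unfolding certified_def by blast
  show ?case by (rule certified_claim[OF *(1), where m = j]) (use Ev.prems j * in auto)
next
  case (Alw f)
  let ?P = "(\<lambda>k. (k, f)) ` {i..i + c}"
  have "\<exists>A D n. cert (surely c) c c X w A D n \<and> (\<forall>(k, f)\<in>?P. loc (w k) (A k) f)"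
    by (rule certified_finite) (use Alw in auto)
  then obtain A D n where *: "cert (surely c) c c X w A D n" "\<forall>(k, f)\<in>?P. loc (w k) (A k) f"
    by blast
  \<comment> \<open>\<open>f\<close> stays in \<open>D\<close> for \<open>c + 1\<close> positions,
    counting both ends; this is exactly what the reach \<open>u = c\<close> and the exit condition
    \<open>b = c\<close> ask for.\<close>
  let ?A = "\<lambda>k. if k = i then {Alw f} else {}" and ?D = "\<lambda>k. if i \<le> k \<and> k \<le> i + c then {f} else {}"
  have "cert (surely c) c c X w (\<lambda>k. A k \<union> ?A k) (\<lambda>k. D k \<union> ?D k) (max n (Suc (i + c)))"
    by (rule cert_Un_gen[OF *(1)]) (use *(2) Alw.prems in \<open>auto split: if_splits intro: loc_mono\<close>)
  moreover have "loc (w i) (A i \<union> ?A i) (Alw f)" by simp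
  ultimately show ?case unfolding certified_def by blast
qed

text \<open>Soundness for a bound \<open>c\<close> that may differ from the one used to build the
  certificate: the hypotheses on \<open>T\<close>, \<open>Ev\<close> and \<open>Alw\<close> say what
  the change of bound requires. \<open>Unt\<close>, \<open>Rel\<close> and \<open>Ev\<close> are
  handled by backward induction from \<open>n\<close>, where labels are empty.\<close>

lemma cert_sound:
  assumes C: "cert T b u X w A D n" and w': "gen w'" "\<And>k. k \<le> n \<Longrightarrow> w' k = w k"
    and T: "\<And>f g. Rel f g \<in> X \<Longrightarrow> g \<in> T \<Longrightarrow> g \<in> surely c"
    and Ev: "\<And>f. Ev f \<in> X \<Longrightarrow> n \<le> c" and Alw: "\<And>f. Alw f \<in> X \<Longrightarrow> c \<le> u"
  shows "loc (w k) (A k) f \<Longrightarrow> k \<le> n \<Longrightarrow> fsat c w' k f"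
proof (induction f arbitrary: k)
  case (Lit P)
  then show ?case using w' by simp
next
  case (Nxt f)
  then have "Nxt f \<in> A k" by simp
  then have "loc (w (Suc k)) (A (Suc k)) f" "k < n"
    using cert_just[OF C, of "Nxt f" k] cert_end[OF C, of k] by (auto simp: not_le[symmetric])
  then show ?case using Nxt.IH by simp
next
  case (Unt f g)
  have "Unt f g \<in> A k \<Longrightarrow> fsat c w' k (Unt f g)" if "k \<le> n" for k
    using that
  proof (induction rule: inc_induct)
    case base
    then show ?case using cert_end[OF C, of n] by simp
  next
    case (step k)
    from cert_just[OF C step.prems] have "loc (w k) (A k) g \<or> loc (w k) (A k) f \<and> Unt f g \<in> A (Suc k)"
      by simp
    then have "fsat c w' k g \<or> fsat c w' k f \<and> fsat c w' (Suc k) (Unt f g)"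
      using Unt.IH step by auto
    then show ?case
    proof
      assume "fsat c w' k f \<and> fsat c w' (Suc k) (Unt f g)"
      then obtain j where j: "Suc k \<le> j" "fsat c w' j g" "fsat c w' k f"
        "\<forall>i. Suc k \<le> i \<and> i < j \<longrightarrow> fsat c w' i f" by auto
      have "fsat c w' i f" if "k \<le> i" "i < j" for i
        using j that by (cases "i = k") auto
      then show ?thesis using j by (auto intro!: exI[of _ j])
    qed auto
  qed
  then show ?case using Unt.prems by simp
next
  case (Rel f g)
  have "Rel f g \<in> A k \<Longrightarrow> fsat c w' k (Rel f g)" if "k \<le> n" for k
    using that
  proof (induction rule: inc_induct)
    case base
    then show ?case using cert_end[OF C, of n] by simp
  next
    case (step k)
    from cert_just[OF C step.prems] consider "w k \<in> B" "g \<in> T"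
      | "loc (w k) (A k) g" "loc (w k) (A k) f \<or> Rel f g \<in> A (Suc k)" by auto
    then show ?case
    proof cases
      case 1
      then have "fsat c w' j g" if "j \<ge> k" for j
        using surelyD[of g c w' j] gen_stays[of w' k j] w' step that T cert_subset[OF C step.prems] by simp
      then show ?thesis by simp
    next
      case 2
      then have *: "fsat c w' k g" "fsat c w' k f \<or> fsat c w' (Suc k) (Rel f g)"
        using Rel.IH step by auto
      have "fsat c w' j g \<or> (\<exists>i. k \<le> i \<and> i < j \<and> fsat c w' i f)" if "j \<ge> k" for j
      proof (cases "j = k")
        case False
        then have "Suc k \<le> j" using that by simp
        show ?thesis
        proof (cases "fsat c w' k f")
          case True
          then show ?thesis using \<open>Suc k \<le> j\<close> by auto
        next
          case False
          then have "fsat c w' j g \<or> (\<exists>i. Suc k \<le> i \<and> i < j \<and> fsat c w' i f)"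
            using * \<open>Suc k \<le> j\<close> by simp
          then show ?thesis using Suc_leD by blast
        qed
      qed (use * in simp)
      then show ?thesis by simp
    qed
  qed
  then show ?case using Rel.prems by simp
next
  case (Ev f)
  have "Ev f \<in> A k \<Longrightarrow> \<exists>j. k \<le> j \<and> j \<le> n \<and> fsat c w' j f" if "k \<le> n" for k
    using that
  proof (induction rule: inc_induct)
    case base
    then show ?case using cert_end[OF C, of n] by simp
  next
    case (step k)
    from cert_just[OF C step.prems] have "loc (w k) (A k) f \<or> Ev f \<in> A (Suc k)" by simp
    then show ?case
    proof
      assume "loc (w k) (A k) f"
      then show ?thesis using Ev.IH[of k] step by (intro exI[of _ k]) simp
    next
      assume "Ev f \<in> A (Suc k)"
      from step.IH[OF this] show ?thesis by (meson Suc_leD)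
    qed
  qed
  moreover have "Ev f \<in> A k" using Ev.prems by simp
  ultimately obtain j where "k \<le> j" "j \<le> n" "fsat c w' j f" using Ev.prems by blast
  moreover have "n \<le> c" using assms(5) cert_subset[OF C \<open>Ev f \<in> A k\<close>] by blast
  ultimately show ?case by (auto intro!: exI[of _ j])
next
  case (Alw f)
  then have k: "Alw f \<in> A k" by simp
  have "fsat c w' (k + j) f" if "j \<le> c" for j
  proof -
    have "c \<le> u" using assms(6) cert_subset[OF C k] by blast
    then have D: "f \<in> D (k + j)" using cert_Alw[OF C k] that by simp
    then have "k + j \<le> n" using cert_end_D[OF C, of "k + j"] by (cases "k + j \<le> n") auto
    then show ?thesis using Alw.IH cert_D[OF C D] by simp
  qed
  then show ?case by (auto simp: le_iff_add)
qed auto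

section \<open>Cutting and pumping certificates\<close>

text \<open>Without \<open>Alw\<close> in \<open>X\<close> the sets \<open>D\<close> are empty, so
  no maintenance period can be damaged by a cut.\<close>

lemma cert_cut:
  assumes "gen w" "cert T b u X w A D n" "loc (w 0) (A 0) f"
    and X: "finite X" "\<And>h. Alw h \<notin> X"
  shows "\<exists>w1 A1 D1 n1. gen w1 \<and> w1 0 = w 0 \<and> cert T b u X w1 A1 D1 n1 \<and> loc (w1 0) (A1 0) f \<and>
    n1 \<le> card S * 2 ^ card X"
  using assms(1-3)
proof (induction n arbitrary: w A D rule: less_induct)
  case (less n)
  note C = less.prems(2)
  show ?case
  proof (cases "n \<le> card S * 2 ^ card X")
    case True
    then show ?thesis using less.prems by blast
  next
    case False
    have "\<not> inj_on (\<lambda>k. (w k, A k)) {..<n}"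
    proof
      assume "inj_on (\<lambda>k. (w k, A k)) {..<n}"
      moreover have "(\<lambda>k. (w k, A k)) ` {..<n} \<subseteq> S \<times> Pow X"
        using gen_in[OF less.prems(1)] cert_subset[OF C] by auto
      ultimately have "card {..<n} \<le> card (S \<times> Pow X)"
        using X finite_S by (intro card_inj_on_le) auto
      then show False using False X by (simp add: card_cartesian_product card_Pow)
    qed
    then obtain p q where pq: "p < q" "q < n" "w p = w q" "A p = A q"
      unfolding inj_on_def by (metis lessThan_iff nat_neq_iff prod.inject)
    define r where "r k = (if k < p then k else k + (q - p))" for k
    define w1 where "w1 k = w (r k)" for k
    define A1 where "A1 k = A (r k)" for k
    \<comment> \<open>\<open>r\<close> skips the positions from \<open>p\<close> to
      \<open>q - 1\<close>; the successor laws survive at the seam because \<open>p\<close> and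
      \<open>q\<close> carry the same state and label.\<close>
    have Suc_r: "w1 (Suc k) = w (Suc (r k))" "A1 (Suc k) = A (Suc (r k))" for k
      using pq by (cases "Suc k = p"; auto simp: w1_def A1_def r_def)+
    have D: "D k = {}" for k using cert_subset_D[OF C] X by blast
    have "gen w1"
    proof (rule gen_tail[OF less.prems(1), where a = p and b = q])
      show "w1 k \<in> S \<and> E (w1 k) (w1 (Suc k))" for k
        unfolding Suc_r using gen_in[OF less.prems(1)] gen_edge[OF less.prems(1)] by (simp add: w1_def)
      show "w1 (k + p) = w (k + q)" for k using pq by (simp add: w1_def r_def)
    qed
    moreover have "cert T b u X w1 A1 (\<lambda>_. {}) (n - (q - p))"
      unfolding cert_def
    proof (intro conjI allI impI ballI)
      fix k assume "n - (q - p) \<le> k"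
      then have "n \<le> r k" using pq by (auto simp: r_def)
      then show "A1 k = {}" using cert_end[OF C] by (simp add: A1_def)
    next
      fix k h assume "h \<in> A1 k"
      then show "just T (w1 k) (A1 k) (w1 (Suc k)) (A1 (Suc k)) h"
        unfolding Suc_r using cert_just[OF C] by (simp add: w1_def A1_def)
    next
      fix k f j assume "Alw f \<in> A1 k"
      then show "f \<in> {}" using cert_subset[OF C] X by (auto simp: A1_def)
    qed (use cert_subset[OF C] in \<open>auto simp: A1_def\<close>)
    moreover have "w1 0 = w 0" "A1 0 = A 0"
      using pq by (auto simp: w1_def A1_def r_def)
    moreover have "n - (q - p) < n" using pq by simp
    ultimately show ?thesis using less.IH[of "n - (q - p)" w1 A1 "\<lambda>_. {}"] less.prems(3) by auto
  qed
qed

text \<open>Claims whose maintenance is not yet known to reach one step beyond \<open>u\<close>.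
  Their number is the quantity that pumping decreases.\<close>

definition short_claims :: "nat \<Rightarrow> (nat \<Rightarrow> 's fm set) \<Rightarrow> (nat \<Rightarrow> 's fm set) \<Rightarrow> ('s fm \<times> nat) set" where
  "short_claims u A D = {(f, k). Alw f \<in> A k \<and> f \<notin> D (k + Suc u)}"

lemma finite_Alw_vimage: "finite X \<Longrightarrow> finite {f. Alw f \<in> X}"
  and card_Alw_vimage: "finite X \<Longrightarrow> card {f. Alw f \<in> X} \<le> card X"
proof -
  assume X: "finite X"
  have sub: "Alw ` {f. Alw f \<in> X} \<subseteq> X" and inj: "inj_on Alw {f. Alw f \<in> X}"
    by (auto simp: inj_on_def)
  show "finite {f. Alw f \<in> X}" using finite_imageD[OF finite_subset[OF sub X] inj] .
  show "card {f. Alw f \<in> X} \<le> card X" using card_inj_on_le[OF inj sub X] .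
qed

lemma finite_short_claims:
  assumes "cert T b u X w A D n" "finite X"
  shows "finite (short_claims u' A D)"
proof (rule finite_subset)
  show "short_claims u' A D \<subseteq> {f. Alw f \<in> X} \<times> {..<n}"
    using cert_subset[OF assms(1)] cert_end[OF assms(1)]
    by (auto simp: short_claims_def not_le[symmetric])
qed (use finite_Alw_vimage assms in auto)

text \<open>
  In a window of length \<open>N\<close> every formula leaves \<open>D\<close> at most once, since it must stay there for \<open>N\<close>
  steps first. Counting these exits in addition to the label gives a repetition without exits in
  between, on which \<open>D\<close> is therefore constant.
\<close>

lemma cert_repetition:
  assumes w: "gen w" and C: "cert T N u X w A D n" and X: "finite X"
    and N: "card S * 2 ^ card X * Suc (card X) < N"
  obtains p q where "k0 < p" "p < q" "q \<le> k0 + N" "w p = w q"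
    "A p - range Alw = A q - range Alw" "\<And>x. p \<le> x \<Longrightarrow> x \<le> q \<Longrightarrow> D x = D p"
proof -
  define ex where "ex k = {(f, e). k0 < e \<and> e < k \<and> f \<in> D e \<and> f \<notin> D (Suc e)}" for k
  \<comment> \<open>Claims \<open>Alw f\<close> are removed and their places reused to record
    \<open>f \<in> D k\<close>. The label remains a subset of \<open>X\<close>, so keeping track of
    \<open>D\<close> costs no further factor.\<close>
  define lab where "lab k = (A k - range Alw) \<union> Alw ` D k" for k
  have fin_ex: "finite (ex k)" for k
  proof (rule finite_subset)
    show "ex k \<subseteq> {f. Alw f \<in> X} \<times> {..<k}"
      using cert_subset_D[OF C] by (auto simp: ex_def)
  qed (use finite_Alw_vimage X in auto)
  have card_ex: "card (ex k) \<le> card X" if "k \<le> k0 + N" for k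
  proof -
    have once: "e = e'" if "(f, e) \<in> ex k" "(f, e') \<in> ex k" "e \<le> e'" for f e e'
    proof (rule ccontr)
      assume "e \<noteq> e'"
      with that have "e' - (e' - Suc e) = Suc e" by simp
      moreover have "e' - Suc e \<le> N" using that \<open>k \<le> k0 + N\<close> by (auto simp: ex_def)
      ultimately have "f \<in> D (Suc e)"
        using cert_exit[OF C, of f e'] that by (auto simp: ex_def dest!: spec[of _ "e' - Suc e"])
      then show False using that by (simp add: ex_def)
    qed
    have "inj_on fst (ex k)"
    proof (rule inj_onI)
      fix x y assume "x \<in> ex k" "y \<in> ex k" "fst x = fst y"
      then show "x = y" using once[of "fst x" "snd x" "snd y"] once[of "fst x" "snd y" "snd x"]
        by (metis nat_le_linear prod.collapse)
    qed
    moreover have "fst ` ex k \<subseteq> {f. Alw f \<in> X}" using cert_subset_D[OF C] by (auto simp: ex_def)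
    ultimately have "card (ex k) \<le> card {f. Alw f \<in> X}"
      using finite_Alw_vimage[OF X] by (rule card_inj_on_le)
    then show ?thesis using card_Alw_vimage[OF X] by simp
  qed
  define \<kappa> where "\<kappa> k = ((w k, lab k), card (ex k))" for k
  have "\<not> inj_on \<kappa> {k0<..k0 + N}"
  proof
    assume inj: "inj_on \<kappa> {k0<..k0 + N}"
    have "\<kappa> ` {k0<..k0 + N} \<subseteq> (S \<times> Pow X) \<times> {..card X}"
      using gen_in[OF w] cert_subset[OF C] cert_subset_D[OF C] card_ex by (auto simp: \<kappa>_def lab_def)
    from card_inj_on_le[OF inj this] have "N \<le> card ((S \<times> Pow X) \<times> {..card X})"
      using X finite_S by simp
    then show False using N X by (simp add: card_cartesian_product card_Pow)
  qed
  then obtain p q where pq: "k0 < p" "p < q" "q \<le> k0 + N" "\<kappa> p = \<kappa> q"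
    unfolding inj_on_def by (metis greaterThanAtMost_iff nat_neq_iff)
  \<comment> \<open>Exit sets grow with the position, so equal cardinality means that no formula
    leaves \<open>D\<close> from \<open>p\<close> to \<open>q - 1\<close>. Then \<open>D\<close>
    increases there, and equal labels make it constant.\<close>
  have "ex p \<subseteq> ex q" using pq by (auto simp: ex_def)
  then have "ex p = ex q" using pq fin_ex by (intro card_subset_eq) (auto simp: \<kappa>_def)
  have no_exit: "f \<in> D (Suc e)" if "f \<in> D e" "p \<le> e" "e < q" for f e
  proof (rule ccontr)
    assume "f \<notin> D (Suc e)"
    then have "(f, e) \<in> ex p" using that pq(1) \<open>ex p = ex q\<close> by (simp add: ex_def)
    then show False using that by (simp add: ex_def)
  qed
  have sub: "D x \<subseteq> D y" if "p \<le> x" "x \<le> y" "y \<le> q" for x y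
    using \<open>x \<le> y\<close> \<open>y \<le> q\<close>
  proof (induction rule: dec_induct)
    case (step z)
    then have "D z \<subseteq> D (Suc z)" using no_exit[of _ z] \<open>p \<le> x\<close> by auto
    then show ?case using step by auto
  qed simp
  have lab: "lab p = lab q" using pq by (simp add: \<kappa>_def)
  have "D k = {f. Alw f \<in> lab k}" for k by (auto simp: lab_def)
  then have "D p = D q" using lab by simp
  then have D: "D x = D p" if "p \<le> x" "x \<le> q" for x
    using sub[of p x] sub[of x q] that by blast
  have "A k - range Alw = lab k - range Alw" for k by (auto simp: lab_def)
  then have "A p - range Alw = A q - range Alw" using lab by simp
  moreover have "w p = w q" using pq by (simp add: \<kappa>_def)
  ultimately show thesis using that[of p q] pq(1-3) D by blast
qed

text \<open>The segment from \<open>p\<close> to \<open>q\<close> is repeated. It lies where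
  \<open>f0\<close> is maintained for the claim at \<open>k0\<close>, so that claim gains at least
  one step. The short claims of the new certificate map injectively to old ones other than
  \<open>(f0, k0)\<close>.\<close>

lemma cert_pump:
  assumes w: "gen w" and C: "cert T N u X w A D n" and l0: "loc (w 0) (A 0) g" and X: "finite X"
    and N: "card S * 2 ^ card X * Suc (card X) < N" and "N \<le> u"
    and bad: "(f0, k0) \<in> short_claims u A D"
  shows "\<exists>w1 A1 D1 n1. gen w1 \<and> w1 0 = w 0 \<and> cert T N u X w1 A1 D1 n1 \<and> loc (w1 0) (A1 0) g \<and>
    card (short_claims u A1 D1) < card (short_claims u A D)"
proof -
  obtain p q where pq: "k0 < p" "p < q" "q \<le> k0 + N" and wpq: "w p = w q"
    and Apq: "A p - range Alw = A q - range Alw" and Dpq: "\<And>x. p \<le> x \<Longrightarrow> x \<le> q \<Longrightarrow> D x = D p"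
    using cert_repetition[OF w C X N] by blast
  define d where "d = q - p"
  have d: "q = p + d" "0 < d" "d < u" using pq \<open>N \<le> u\<close> by (auto simp: d_def)
  \<comment> \<open>The second copy of the segment starts at \<open>q\<close> with
    \<open>r q = p\<close>; the old position \<open>q\<close> reappears at
    \<open>q + d\<close>.\<close>
  define r where "r k = (if k < q then k else k - d)" for k
  define w1 where "w1 k = w (r k)" for k
  define D1 where "D1 k = D (r k)" for k
  \<comment> \<open>The labels at \<open>p\<close> and \<open>q\<close> may differ in \<open>Alw\<close>-claims. The claims of \<open>q\<close> are needed by position
      \<open>q - 1\<close>, and they remain correct at the second copy of \<open>p\<close> because \<open>D\<close> is constant.\<close>
  define A1 where "A1 k = (if k = q then A p \<union> A q else A (r k))" for k
  have rq: "r q = p" using d by (simp add: r_def)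
  have Dq: "D q = D p" using Dpq[of q] pq by simp
  have A1_sup: "A (r k) \<subseteq> A1 k" for k by (auto simp: A1_def rq)
  have w_Suc: "w1 (Suc k) = w (Suc (r k))" for k
    using wpq d rq by (cases "Suc k = q") (auto simp: w1_def r_def Suc_diff_le)
  have D_Suc: "D1 (Suc k) = D (Suc (r k))" for k
    using Dq d rq by (cases "Suc k = q") (auto simp: D1_def r_def Suc_diff_le)
  have A_Suc: "A (Suc (r k)) \<subseteq> A1 (Suc k)" for k
    using d rq by (cases "Suc k = q") (auto simp: A1_def r_def Suc_diff_le)
  have A1_cases: "k < q \<and> h \<in> A k \<or> k = q \<and> h \<in> A p \<or> k = q \<and> h \<in> A q \<or> k > q \<and> h \<in> A (k - d)"
    if "h \<in> A1 k" for h k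
    using that by (cases k q rule: linorder_cases) (auto simp: A1_def r_def)
  have "gen w1"
  proof (rule gen_tail[OF w, where a = q and b = p])
    show "w1 k \<in> S \<and> E (w1 k) (w1 (Suc k))" for k
      unfolding w_Suc using gen_in[OF w] gen_edge[OF w] by (simp add: w1_def)
    show "w1 (k + q) = w (k + p)" for k using d by (simp add: w1_def r_def)
  qed
  have reach: "f \<in> D1 (k + j)" if "Alw f \<in> A1 k" "j \<le> u" for f k j
  proof -
    consider "k < q" "Alw f \<in> A k" | "k = q" "Alw f \<in> A p" | "k = q" "Alw f \<in> A q"
      | "k > q" "Alw f \<in> A (k - d)"
      using A1_cases[OF \<open>Alw f \<in> A1 k\<close>] by blast
    then show ?thesis
    proof cases
      case 1
      note k = cert_Alw[OF C 1(2)]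
      \<comment> \<open>Before the copy nothing changes, within it constancy of \<open>D\<close>
        applies, and after it \<open>k + j\<close> corresponds to the old position
        \<open>k + j - d\<close>.\<close>
      consider "k + j < q" | "q \<le> k + j" "k + j \<le> q + d" | "q + d < k + j" by linarith
      then show ?thesis
      proof cases
        case 1
        then show ?thesis using k that by (simp add: D1_def r_def)
      next
        case 2
        then have "f \<in> D p" using k[of "q - k"] \<open>k < q\<close> that Dq by simp
        then show ?thesis using 2 d Dpq[of "k + j - d"] by (simp add: D1_def r_def)
      next
        case 3
        then show ?thesis using k[of "j - d"] that d \<open>k < q\<close> by (simp add: D1_def r_def)
      qed
    next
      case 2
      then show ?thesis using cert_Alw[OF C 2(2), of j] that d by (simp add: D1_def r_def)
    next
      case 3
      show ?thesis
      proof (cases "j \<le> d")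
        case True
        then show ?thesis using cert_Alw[OF C 3(2), of 0] 3 d Dq Dpq[of "p + j"]
          by (simp add: D1_def r_def)
      next
        case False
        then show ?thesis using cert_Alw[OF C 3(2), of "j - d"] that 3 d by (simp add: D1_def r_def)
      qed
    next
      case 4
      then show ?thesis using cert_Alw[OF C 4(2), of j] that d by (simp add: D1_def r_def)
    qed
  qed
  have C1: "cert T N u X w1 A1 D1 (n + d)"
    unfolding cert_def
  proof (intro conjI allI impI ballI)
    fix k assume k: "n + d \<le> k"
    then have "n \<le> r k" by (auto simp: r_def)
    then show "D1 k = {}" using cert_end_D[OF C] by (simp add: D1_def)
    show "A1 k = {}" using cert_end[OF C] k \<open>n \<le> r k\<close> d by (auto simp: A1_def)
  next
    fix k h assume h: "h \<in> A1 k"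
    show "just T (w1 k) (A1 k) (w1 (Suc k)) (A1 (Suc k)) h"
    proof (cases "h \<in> range Alw")
      case False
      then have "h \<in> A (r k)" using h Apq rq by (auto simp: A1_def split: if_splits)
      from just_mono[OF cert_just[OF C this] A1_sup A_Suc] show ?thesis
        by (simp add: w1_def[of k] w_Suc)
    qed auto
  next
    fix k f assume "f \<in> D1 k"
    then show "loc (w1 k) (A1 k) f"
      using loc_mono[OF cert_D[OF C] A1_sup] by (simp add: w1_def D1_def)
  next
    fix k f assume "f \<in> D1 k" "f \<notin> D1 (Suc k)"
    then have ex: "N \<le> r k" "\<And>j. j \<le> N \<Longrightarrow> f \<in> D (r k - j)"
      using cert_exit[OF C, of f "r k"] D_Suc by (auto simp: D1_def)
    then show "N \<le> k" by (auto simp: r_def split: if_splits)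
    fix j assume j: "j \<le> N"
    \<comment> \<open>Looking back \<open>N\<close> steps may cross the seam. In the last case the
      old look-back passes \<open>p\<close>, and constancy of \<open>D\<close> carries
      \<open>f\<close> from \<open>p\<close> over the first copy.\<close>
    consider "k < q" | "q \<le> k" "q \<le> k - j" | "q \<le> k" "k - j < q" "d \<le> j" | "q \<le> k" "k - j < q" "j < d"
      by linarith
    then show "f \<in> D1 (k - j)"
    proof cases
      case 1
      then have "k - j < q" by simp
      then show ?thesis using 1 ex(2)[OF j] by (simp add: D1_def r_def)
    next
      case 2
      then show ?thesis using ex(2)[OF j] by (simp add: D1_def r_def add.commute)
    next
      case 3
      then show ?thesis using ex(2)[of "j - d"] j by (simp add: D1_def r_def)
    next
      case 4
      then have "f \<in> D p" using ex(2)[of "k - d - p"] j d by (simp add: r_def)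
      then show ?thesis using 4 d Dpq[of "k - j"] by (simp add: D1_def r_def)
    qed
  qed (use reach cert_subset[OF C] cert_subset_D[OF C] in
      \<open>auto simp: A1_def D1_def split: if_splits\<close>)
  have Alw0: "Alw f0 \<in> A k0" and "f0 \<notin> D (k0 + Suc u)" using bad by (auto simp: short_claims_def)
  \<comment> \<open>A new short claim before \<open>q\<close> satisfies
    \<open>k + Suc u \<le> q \<le> k0 + u\<close>, hence starts before \<open>k0\<close>; positions
    from \<open>q\<close> on have images at least \<open>p > k0\<close>. So none is mapped to
    \<open>k0\<close>, and \<open>r\<close> is injective on those left.\<close>
  have old: "Alw f \<in> A (r k) \<and> f \<notin> D (r k + Suc u) \<and> (k < q \<longrightarrow> k < k0)"
    if "(f, k) \<in> short_claims u A1 D1" for f k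
  proof -
    from that have f: "Alw f \<in> A1 k" "f \<notin> D1 (k + Suc u)" by (auto simp: short_claims_def)
    consider "k < q" "Alw f \<in> A k" | "k = q" "Alw f \<in> A p" | "k = q" "Alw f \<in> A q"
      | "k > q" "Alw f \<in> A (k - d)"
      using A1_cases[OF f(1)] by blast
    then show ?thesis
    proof cases
      case 1
      note k = cert_Alw[OF C 1(2)]
      have "k + Suc u \<le> q"
      proof (rule ccontr)
        assume *: "\<not> k + Suc u \<le> q"
        show False
        proof (cases "k + Suc u \<le> q + d")
          case True
          have "f \<in> D p" using k[of "q - k"] * 1 Dq by simp
          then show False using f(2) * True d Dpq[of "k + Suc u - d"] by (simp add: D1_def r_def)
        next
          case False
          then show False using k[of "Suc u - d"] d f(2) by (simp add: D1_def r_def)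
        qed
      qed
      then have "D1 (k + Suc u) = D (k + Suc u)"
        using Dq rq by (cases "k + Suc u = q") (auto simp: D1_def r_def)
      then show ?thesis using 1 f \<open>k + Suc u \<le> q\<close> pq \<open>N \<le> u\<close> by (simp add: r_def)
    next
      case 2
      then show ?thesis using f(2) d by (simp add: D1_def r_def)
    next
      case 3
      have "f \<in> D1 (q + Suc u)"
        using cert_Alw[OF C 3(2), of "Suc u - d"] d by (simp add: D1_def r_def)
      then show ?thesis using f(2) 3 by simp
    next
      case 4
      then show ?thesis using f(2) d by (simp add: D1_def r_def Suc_diff_le)
    qed
  qed
  let ?m = "\<lambda>(f, k). (f, r k)"
  have "?m ` short_claims u A1 D1 \<subseteq> short_claims u A D - {(f0, k0)}"
    using old pq d by (fastforce simp: short_claims_def r_def split: if_splits)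
  moreover have "inj_on ?m (short_claims u A1 D1)"
  proof (rule inj_onI)
    fix x y assume "x \<in> short_claims u A1 D1" "y \<in> short_claims u A1 D1" "?m x = ?m y"
    then show "x = y"
      using old[of "fst x" "snd x"] old[of "fst y" "snd y"] pq d
      by (cases x; cases y) (auto simp: r_def split: if_splits)
  qed
  ultimately have "card (short_claims u A1 D1) \<le> card (short_claims u A D - {(f0, k0)})"
    using finite_short_claims[OF C X] by (intro card_inj_on_le) auto
  also have "\<dots> < card (short_claims u A D)"
    using finite_short_claims[OF C X] bad by (intro psubset_card_mono) auto
  finally have "card (short_claims u A1 D1) < card (short_claims u A D)" .
  moreover have "w1 0 = w 0" "A1 0 = A 0" using pq by (auto simp: w1_def A1_def r_def)
  ultimately show ?thesis using \<open>gen w1\<close> C1 l0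
    by (intro exI[of _ w1] exI[of _ A1] exI[of _ D1] exI[of _ "n + d"]) simp
qed

text \<open>Pumping is repeated until no short claim is left; then all claims reach
  \<open>Suc u\<close>. The exit bound \<open>N\<close> stays fixed, so the same window length
  serves every round.\<close>

lemma cert_stretch_Suc:
  assumes "gen w" "cert T N u X w A D n" "loc (w 0) (A 0) g" and X: "finite X"
    and N: "card S * 2 ^ card X * Suc (card X) < N" and "N \<le> u"
  shows "\<exists>w1 A1 D1 n1. gen w1 \<and> w1 0 = w 0 \<and> cert T N (Suc u) X w1 A1 D1 n1 \<and> loc (w1 0) (A1 0) g"
  using assms(1-3)
proof (induction "card (short_claims u A D)" arbitrary: w A D n rule: less_induct)
  case less
  note C = less.prems(2)
  show ?case
  proof (cases "short_claims u A D = {}")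
    case True
    have "f \<in> D (k + j)" if "Alw f \<in> A k" "j \<le> Suc u" for f k j
      using that True cert_Alw[OF C that(1), of j] by (cases "j = Suc u") (auto simp: short_claims_def)
    then have "cert T N (Suc u) X w A D n"
      using C unfolding cert_def by auto
    then show ?thesis using less.prems by blast
  next
    case False
    then obtain f0 k0 where "(f0, k0) \<in> short_claims u A D" by auto
    from cert_pump[OF less.prems X N \<open>N \<le> u\<close> this] obtain w1 A1 D1 n1 where
      1: "gen w1" "w1 0 = w 0" "cert T N u X w1 A1 D1 n1" "loc (w1 0) (A1 0) g"
        "card (short_claims u A1 D1) < card (short_claims u A D)" by blast
    from less.hyps[OF 1(5,1,3,4)] 1(2) show ?thesis by simp
  qed
qed

lemma cert_stretch:
  assumes "gen w" "cert T N N X w A D n" "loc (w 0) (A 0) g" and X: "finite X"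
    and N: "card S * 2 ^ card X * Suc (card X) < N" and "N \<le> u"
  shows "\<exists>w1 A1 D1 n1. gen w1 \<and> w1 0 = w 0 \<and> cert T N u X w1 A1 D1 n1 \<and> loc (w1 0) (A1 0) g"
  using \<open>N \<le> u\<close>
proof (induction rule: dec_induct)
  case base
  then show ?case using assms(1-3) by blast
next
  case (step u)
  then obtain w1 A1 D1 n1 where "gen w1" "w1 0 = w 0" "cert T N u X w1 A1 D1 n1" "loc (w1 0) (A1 0) g"
    by blast
  with cert_stretch_Suc[OF this(1,3,4) X N step(1)] show ?case by metis
qed

section \<open>Transfer between two bounds\<close>

lemma size_Rel_tsub: "Rel f g \<in> tsub h \<Longrightarrow> size g < size h"
  using size_tsub[of "Rel f g" h] by simp

text \<open>
  The two halves depend on each other: cutting a certificate for \<open>u\<close> requires that formulas which are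
  sure for \<open>u\<close> are sure for \<open>N\<close>, and this is the contrapositive of pumping for their negations.
\<close>

lemma bound_transfer:
  assumes "card S * 2 ^ card (tsub f) * Suc (card (tsub f)) < N" "N \<le> u"
  shows "((\<forall>h. Alw h \<notin> tsub f) \<longrightarrow> (\<forall>w. gen w \<and> fsat u w 0 f \<longrightarrow>
      (\<exists>w1 n. gen w1 \<and> w1 0 = w 0 \<and> (\<forall>w'. gen w' \<and> (\<forall>k\<le>n. w' k = w1 k) \<longrightarrow> fsat N w' 0 f)))) \<and>
    ((\<forall>h. Ev h \<notin> tsub f) \<longrightarrow> (\<forall>w. gen w \<and> fsat N w 0 f \<longrightarrow>
      (\<exists>w1. gen w1 \<and> w1 0 = w 0 \<and> fsat u w1 0 f)))"
  using assms(1)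
proof (induction "size f" arbitrary: f rule: less_induct)
  case less
  note N = less.prems
  have sub: "card S * 2 ^ card (tsub g) * Suc (card (tsub g)) < N" if "h \<in> tsub f" "tsub g \<subseteq> tsub h" for g h
  proof -
    have "tsub g \<subseteq> tsub f" using tsub_trans[OF that(1)] that(2) by blast
    then have "card (tsub g) \<le> card (tsub f)" by (intro card_mono) auto
    then have "card S * 2 ^ card (tsub g) * Suc (card (tsub g)) \<le>
        card S * 2 ^ card (tsub f) * Suc (card (tsub f))"
      by (intro mult_le_mono) (auto intro: power_increasing)
    then show ?thesis using N by simp
  qed
  have sub_neg: "card S * 2 ^ card (tsub (neg g)) * Suc (card (tsub (neg g))) < N"
    "size (neg g) < size f" "tsub g \<subseteq> tsub f" if "Rel g' g \<in> tsub f" for g g'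
    using sub[OF that, of g] size_Rel_tsub[OF that] tsub_trans[OF that] by (auto simp: card_tsub_neg)
  show ?case
  proof (intro conjI impI allI)
    fix w assume noAlw: "\<forall>h. Alw h \<notin> tsub f" and w: "gen w \<and> fsat u w 0 f"
    obtain A D n where 1: "cert (surely u) u u (tsub f) w A D n" "loc (w 0) (A 0) f"
      using certified_fsat[of w u 0 f "tsub f"] w unfolding certified_def by blast
    from cert_cut[OF _ this] w noAlw obtain w1 A1 D1 n1 where w1: "gen w1" "w1 0 = w 0"
      "cert (surely u) u u (tsub f) w1 A1 D1 n1" "loc (w1 0) (A1 0) f"
      "n1 \<le> card S * 2 ^ card (tsub f)" by auto
    have "g \<in> surely N" if g: "Rel g' g \<in> tsub f" "g \<in> surely u" for g g'
    proof (rule ccontr)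
      assume "g \<notin> surely N"
      then obtain w2 where w2: "gen w2" "w2 0 \<in> B" "fsat N w2 0 (neg g)"
        unfolding surely_def by auto
      \<comment> \<open>Negation exchanges \<open>Ev\<close> and \<open>Alw\<close>, so the other
        half of the induction hypothesis applies to \<open>neg g\<close>, which is smaller than
        \<open>f\<close>.\<close>
      have "Ev h \<notin> tsub (neg g)" for h
        using noAlw sub_neg(3)[OF g(1)] by (auto simp: Ev_in_tsub_neg Alw_in_tsub_neg)
      then obtain w3 where "gen w3" "w3 0 = w2 0" "fsat u w3 0 (neg g)"
        using less.hyps[OF sub_neg(2,1)[OF g(1)]] w2 by blast
      then show False using g(2) w2 surelyD[of g u w3 0] by simp
    qed
    moreover have "n1 \<le> N" using w1(5) N by (auto intro: order_trans)
    ultimately have "fsat N w' 0 f" if "gen w'" "\<forall>k\<le>n1. w' k = w1 k" for w'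
      by (intro cert_sound[OF w1(3) that(1) _ _ _ _ w1(4)]) (use that noAlw in auto)
    then show "\<exists>w1 n. gen w1 \<and> w1 0 = w 0 \<and> (\<forall>w'. gen w' \<and> (\<forall>k\<le>n. w' k = w1 k) \<longrightarrow> fsat N w' 0 f)"
      using w1 by blast
  next
    fix w assume noEv: "\<forall>h. Ev h \<notin> tsub f" and w: "gen w \<and> fsat N w 0 f"
    obtain A D n where 1: "cert (surely N) N N (tsub f) w A D n" "loc (w 0) (A 0) f"
      using certified_fsat[of w N 0 f "tsub f"] w unfolding certified_def by blast
    from cert_stretch[OF _ this _ N \<open>N \<le> u\<close>] w obtain w1 A1 D1 n1 where w1: "gen w1" "w1 0 = w 0"
      "cert (surely N) N u (tsub f) w1 A1 D1 n1" "loc (w1 0) (A1 0) f" by auto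
    have "g \<in> surely u" if g: "Rel g' g \<in> tsub f" "g \<in> surely N" for g g'
    proof (rule ccontr)
      assume "g \<notin> surely u"
      then obtain w2 where w2: "gen w2" "w2 0 \<in> B" "fsat u w2 0 (neg g)"
        unfolding surely_def by auto
      have "Alw h \<notin> tsub (neg g)" for h
        using noEv sub_neg(3)[OF g(1)] by (auto simp: Ev_in_tsub_neg Alw_in_tsub_neg)
      then obtain w3 n where "gen w3" "w3 0 = w2 0" "\<forall>w'. gen w' \<and> (\<forall>k\<le>n. w' k = w3 k) \<longrightarrow> fsat N w' 0 (neg g)"
        using less.hyps[OF sub_neg(2,1)[OF g(1)]] w2 by blast
      then show False using g(2) w2 surelyD[of g N w3 0] by simp
    qed
    then have "fsat u w1 0 f"
      by (intro cert_sound[OF w1(3,1) _ _ _ _ w1(4)]) (use noEv in auto)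
    then show "\<exists>w1. gen w1 \<and> w1 0 = w 0 \<and> fsat u w1 0 f" using w1 by blast
  qed
qed

end

section \<open>Almost every path is recurrent\<close>

lemma INFM_shift_nat: "\<exists>\<^sub>\<infinity>i. P (i + k) \<Longrightarrow> \<exists>\<^sub>\<infinity>i. P (i::nat)"
  unfolding INFM_nat_le by (meson trans_le_add1)

section \<open>Cylinder sets and their probabilities\<close>

definition cyl :: "'s list \<Rightarrow> (nat \<Rightarrow> 's) set" where
  "cyl xs = {\<omega>. \<forall>i<length xs. \<omega> i = xs ! i}"

lemma cyl_append: "cyl (xs @ ys) \<subseteq> cyl xs"
  by (auto simp: cyl_def nth_append)

lemma cyl_append_iff:
  "\<omega> \<in> cyl (xs @ ys) \<longleftrightarrow> \<omega> \<in> cyl xs \<and> (\<forall>k<length ys. \<omega> (length xs + k) = ys ! k)"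
proof
  assume *: "\<omega> \<in> cyl (xs @ ys)"
  have "\<omega> (length xs + k) = ys ! k" if "k < length ys" for k
    using * that unfolding cyl_def by (auto dest!: spec[of _ "length xs + k"])
  with * show "\<omega> \<in> cyl xs \<and> (\<forall>k<length ys. \<omega> (length xs + k) = ys ! k)"
    using cyl_append by blast
next
  assume *: "\<omega> \<in> cyl xs \<and> (\<forall>k<length ys. \<omega> (length xs + k) = ys ! k)"
  have "\<omega> i = (xs @ ys) ! i" if "i < length xs + length ys" for i
    using * that by (cases "i < length xs")
      (auto simp: cyl_def nth_append dest!: spec[of _ "i - length xs"])
  then show "\<omega> \<in> cyl (xs @ ys)" by (simp add: cyl_def)
qed

lemma in_cyl_map: "\<omega> \<in> cyl (map \<omega> [0..<n])"
  by (simp add: cyl_def)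

lemma cyl_eqD: "\<omega> \<in> cyl xs \<Longrightarrow> \<omega> \<in> cyl ys \<Longrightarrow> length xs = length ys \<Longrightarrow> xs = ys"
  by (auto simp: cyl_def intro!: nth_equalityI)

lemma cyl_disjoint: "length zs = length zs' \<Longrightarrow> zs \<noteq> zs' \<Longrightarrow> cyl (xs @ zs) \<inter> cyl (xs @ zs') = {}"
  using cyl_eqD by fastforce

locale finite_chain =
  fixes M :: "('s, 'ap) markov_chain"
  assumes finite_chain: "finite_markov_chain M"
begin

abbreviation "\<mu> \<equiv> path_measure M"

sublocale prob_space \<mu>
  by (rule prob_space_path_measure)

abbreviation edge :: "'s \<Rightarrow> 's \<Rightarrow> bool" where
  "edge s t \<equiv> t \<in> set_pmf (trans_prob M s)"

lemma finite_states: "finite (states M)"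
  and init_in: "init_state M \<in> states M"
  and edge_in: "s \<in> states M \<Longrightarrow> edge s t \<Longrightarrow> t \<in> states M"
  using finite_chain unfolding finite_markov_chain_def by auto

lemma measurable_at [measurable]: "Measurable.pred \<mu> (\<lambda>\<omega>. Q (\<omega> i))"
proof -
  have "Measurable.pred (PiM UNIV (\<lambda>_::nat. count_space (UNIV :: 's set))) (\<lambda>\<omega>. Q (\<omega> i))"
    by (rule measurable_compose[OF measurable_component_singleton[of i UNIV]]) auto
  then show ?thesis using measurable_cong_sets[OF sets_path_measure refl] by blast
qed

lemma sets_cyl [measurable]: "cyl xs \<in> sets \<mu>"
proof -
  have "Measurable.pred \<mu> (\<lambda>\<omega>. \<forall>i\<in>{..<length xs}. \<omega> i = xs ! i)"
    by measurable
  then show ?thesis by (simp add: cyl_def pred_def space_path_measure Ball_def)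
qed

lemma measure_cyl:
  assumes "xs \<noteq> []"
  shows "measure \<mu> (cyl xs) = (if hd xs = init_state M
    then \<Prod>i<length xs - 1. pmf (trans_prob M (xs ! i)) (xs ! Suc i) else 0)"
proof -
  have "cyl xs = {\<omega>. \<forall>i\<le>length xs - 1. \<omega> i = xs ! i}"
    using assms by (auto simp: cyl_def less_Suc_eq_le[symmetric])
  then show ?thesis
    using emeasure_path_measure_cylinder[of M "length xs - 1" "(!) xs"] assms
    by (simp add: measure_def hd_conv_nth prod_ennreal prod_nonneg)
qed

lemma measure_cyl_snoc:
  assumes "xs \<noteq> []"
  shows "measure \<mu> (cyl (xs @ [t])) = measure \<mu> (cyl xs) * pmf (trans_prob M (last xs)) t"
proof -
  obtain m where m: "length xs = Suc m" using assms by (cases xs) auto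
  have "(\<Prod>i<Suc m. pmf (trans_prob M ((xs @ [t]) ! i)) ((xs @ [t]) ! Suc i)) =
      (\<Prod>i<m. pmf (trans_prob M (xs ! i)) (xs ! Suc i)) * pmf (trans_prob M (last xs)) t"
    unfolding prod.lessThan_Suc
    by (rule arg_cong2[where f = "(*)"], rule prod.cong)
      (use assms m in \<open>auto simp: nth_append last_conv_nth\<close>)
  then show ?thesis using assms m by (simp add: measure_cyl)
qed

primrec prob_from :: "'s \<Rightarrow> 's list \<Rightarrow> real" where
  "prob_from s [] = 1"
| "prob_from s (t # ts) = pmf (trans_prob M s) t * prob_from t ts"

lemma measure_cyl_append:
  "xs \<noteq> [] \<Longrightarrow> measure \<mu> (cyl (xs @ ys)) = measure \<mu> (cyl xs) * prob_from (last xs) ys"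
proof (induction ys arbitrary: xs)
  case (Cons t ts)
  from Cons.IH[of "xs @ [t]"] show ?case
    using Cons.prems by (simp add: measure_cyl_snoc mult.assoc)
qed simp

lemma prob_from_nonneg: "0 \<le> prob_from s ys"
  by (induction ys arbitrary: s) auto

lemma prob_from_pos:
  "(\<And>k. k < length ys \<Longrightarrow> edge ((s # ys) ! k) (ys ! k)) \<Longrightarrow> 0 < prob_from s ys"
proof (induction ys arbitrary: s)
  case (Cons t ts)
  have "edge s t" using Cons.prems[of 0] by simp
  moreover have "0 < prob_from t ts"
    by (rule Cons.IH) (use Cons.prems[of "Suc k" for k] in auto)
  ultimately show ?case by (simp add: pmf_positive)
qed simp

lemma AE_init: "AE \<omega> in \<mu>. \<omega> 0 = init_state M"
proof -
  have "prob {\<omega> \<in> space \<mu>. \<omega> 0 = init_state M} = 1"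
    using measure_cyl[of "[init_state M]"] by (simp add: cyl_def space_path_measure)
  then show ?thesis by (subst (asm) prob_Collect_eq_1) auto
qed

text \<open>The one-step extensions along edges already carry the whole mass of the
  cylinder.\<close>

lemma AE_next:
  assumes "xs \<noteq> []" "last xs \<in> states M"
  shows "AE \<omega> in \<mu>. \<omega> \<in> cyl xs \<longrightarrow> edge (last xs) (\<omega> (length xs))"
proof -
  let ?T = "set_pmf (trans_prob M (last xs))"
  have "?T \<subseteq> states M" using edge_in[OF assms(2)] by blast
  then have fin: "finite ?T" using finite_states finite_subset by blast
  have disj: "disjoint_family_on (\<lambda>t. cyl (xs @ [t])) ?T"
    unfolding disjoint_family_on_def by (intro ballI impI cyl_disjoint) auto
  have "prob (\<Union>t\<in>?T. cyl (xs @ [t])) = (\<Sum>t\<in>?T. prob (cyl (xs @ [t])))"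
    by (rule finite_measure_finite_Union[OF fin _ disj]) auto
  also have "\<dots> = prob (cyl xs)"
    using assms fin by (simp add: measure_cyl_snoc sum_distrib_left[symmetric] sum_pmf_eq_1)
  finally have "prob (cyl xs - (\<Union>t\<in>?T. cyl (xs @ [t]))) = 0"
    using fin cyl_append[of xs] by (subst finite_measure_Diff) auto
  then have "AE \<omega> in \<mu>. \<omega> \<notin> cyl xs - (\<Union>t\<in>?T. cyl (xs @ [t]))"
    using fin by (subst (asm) prob_eq_0) (auto intro!: sets.Diff sets.finite_UN)
  then show ?thesis
    by eventually_elim (auto simp: cyl_append_iff)
qed

lemma AE_path: "AE \<omega> in \<mu>. \<forall>k. \<omega> k \<in> states M \<and> edge (\<omega> k) (\<omega> (Suc k))"
proof -
  let ?L = "{xs \<in> lists (states M). xs \<noteq> []}"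
  have "countable ?L"
    using finite_states by (intro countable_subset[OF _ countable_lists[of "states M"]]) (auto intro: countable_finite)
  then have "AE \<omega> in \<mu>. \<forall>xs\<in>?L. \<omega> \<in> cyl xs \<longrightarrow> edge (last xs) (\<omega> (length xs))"
    by (subst AE_ball_countable) (auto intro!: AE_next dest: last_in_set)
  with AE_init show ?thesis
  proof eventually_elim
    case (elim \<omega>)
    have step: "edge (\<omega> k) (\<omega> (Suc k))" if "\<forall>i\<le>k. \<omega> i \<in> states M" for k
    proof -
      have "map \<omega> [0..<Suc k] \<in> ?L" using that by auto
      from elim(2)[rule_format, OF this in_cyl_map] show ?thesis by simp
    qed
    have "\<forall>i\<le>k. \<omega> i \<in> states M" for k
    proof (induction k)
      case (Suc k)
      then show ?case using edge_in[OF _ step[OF Suc]] by (auto simp: le_Suc_eq)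
    qed (use elim init_in in auto)
    with step show ?case by blast
  qed
qed

text \<open>Piecewise estimate over a countable disjoint refinement. The bound keeps the measure of
  the union, which may be smaller than that of \<open>cyl xs\<close>; one application gains its
  factor from this.\<close>

lemma measure_Int_cyl_le:
  assumes [measurable]: "A \<in> sets \<mu>" and Z: "countable Z" and "0 \<le> c"
    and disj: "disjoint_family_on (\<lambda>zs. cyl (xs @ zs)) Z"
    and cover: "AE \<omega> in \<mu>. \<omega> \<in> A \<inter> cyl xs \<longrightarrow> (\<exists>zs\<in>Z. \<omega> \<in> cyl (xs @ zs))"
    and le: "\<And>zs. zs \<in> Z \<Longrightarrow> measure \<mu> (A \<inter> cyl (xs @ zs)) \<le> c * measure \<mu> (cyl (xs @ zs))"
  shows "measure \<mu> (A \<inter> cyl xs) \<le> c * measure \<mu> (\<Union>zs\<in>Z. cyl (xs @ zs))"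
proof -
  have [measurable]: "(\<Union>zs\<in>Z. cyl (xs @ zs)) \<in> sets \<mu>" "(\<Union>zs\<in>Z. A \<inter> cyl (xs @ zs)) \<in> sets \<mu>"
    using Z by (auto intro!: sets.countable_UN')
  have "emeasure \<mu> (A \<inter> cyl xs) \<le> emeasure \<mu> (\<Union>zs\<in>Z. A \<inter> cyl (xs @ zs))"
  proof (rule emeasure_mono_AE)
    show "AE \<omega> in \<mu>. \<omega> \<in> A \<inter> cyl xs \<longrightarrow> \<omega> \<in> (\<Union>zs\<in>Z. A \<inter> cyl (xs @ zs))"
      using cover by eventually_elim auto
  qed simp
  also have "\<dots> = (\<integral>\<^sup>+zs. emeasure \<mu> (A \<inter> cyl (xs @ zs)) \<partial>count_space Z)"
    using Z disj by (intro emeasure_UN_countable) (auto simp: disjoint_family_on_def)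
  also have "\<dots> \<le> (\<integral>\<^sup>+zs. ennreal c * emeasure \<mu> (cyl (xs @ zs)) \<partial>count_space Z)"
    using le \<open>0 \<le> c\<close> by (intro nn_integral_mono)
      (auto simp: emeasure_eq_measure ennreal_mult'[symmetric] intro!: ennreal_leI)
  also have "\<dots> = ennreal c * emeasure \<mu> (\<Union>zs\<in>Z. cyl (xs @ zs))"
    using Z disj by (simp add: nn_integral_cmult emeasure_UN_countable)
  finally show ?thesis
    using \<open>0 \<le> c\<close> by (simp add: emeasure_eq_measure ennreal_mult'[symmetric])
qed

text \<open>At each visit to \<open>s\<close>, \<open>ys\<close> follows with conditional
  probability \<open>p > 0\<close>, so avoiding it in \<open>k\<close> successive attempts has
  probability at most \<open>(1 - p) ^ k\<close>, which tends to \<open>0\<close>.\<close>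

lemma visits_without_path_null:
  assumes p: "0 < prob_from s ys"
  shows "AE \<omega> in \<mu>. (\<exists>\<^sub>\<infinity>i. \<omega> i = s) \<longrightarrow> (\<exists>i\<ge>N. \<omega> i = s \<and> (\<forall>k<length ys. \<omega> (Suc i + k) = ys ! k))"
proof -
  define p where "p = prob_from s ys"
  define A where "A = {\<omega>. (\<exists>\<^sub>\<infinity>i. \<omega> i = s) \<and>
    \<not> (\<exists>i\<ge>N. \<omega> i = s \<and> (\<forall>k<length ys. \<omega> (Suc i + k) = ys ! k))}"
  have A [measurable]: "A \<in> sets \<mu>"
  proof -
    have "Measurable.pred \<mu> (\<lambda>\<omega>. (\<forall>m. \<exists>i\<in>{m..}. \<omega> i = s) \<and>
        \<not> (\<exists>i\<in>{N..}. \<omega> i = s \<and> (\<forall>k\<in>{..<length ys}. \<omega> (Suc i + k) = ys ! k)))"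
      by measurable
    moreover have "A = {\<omega> \<in> space \<mu>. (\<forall>m. \<exists>i\<in>{m..}. \<omega> i = s) \<and>
        \<not> (\<exists>i\<in>{N..}. \<omega> i = s \<and> (\<forall>k\<in>{..<length ys}. \<omega> (Suc i + k) = ys ! k))}"
      unfolding A_def INFM_nat_le space_path_measure by auto
    ultimately show ?thesis by (simp add: pred_def)
  qed
  have countable_lists_states: "countable (lists (states M))"
    using finite_states by (intro countable_lists countable_finite)
  have p1: "p \<le> 1"
  proof -
    have "prob_from s ys \<le> 1" for s ys
      by (induction ys arbitrary: s)
        (auto intro!: mult_le_one pmf_le_1 intro: prob_from_nonneg)
    then show ?thesis by (simp add: p_def)
  qed
  \<comment> \<open>\<open>k\<close> counts visits to \<open>s\<close>: split a cylinder according to the first visit to \<open>s\<close>, after which \<open>ys\<close>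
      is avoided with probability \<open>1 - p\<close>.\<close>
  have bound: "measure \<mu> (A \<inter> cyl xs) \<le> (1 - p) ^ k * measure \<mu> (cyl xs)" if "N < length xs" for k xs
    using that
  proof (induction k arbitrary: xs)
    case 0
    then show ?case by (auto intro!: finite_measure_mono)
  next
    case (Suc k)
    \<comment> \<open>\<open>us\<close> ends with a visit at position \<open>length us - 1\<close>,
      which is at least \<open>N\<close>, so on \<open>A\<close> the next \<open>length ys\<close>
      states differ from \<open>ys\<close>; this excludes the fraction \<open>p\<close> of the
      cylinder.\<close>
    have visit: "measure \<mu> (A \<inter> cyl us) \<le> (1 - p) ^ Suc k * measure \<mu> (cyl us)"
      if us: "N < length us" "last us = s" for us
    proof -
      let ?Z = "{zs \<in> lists (states M). length zs = length ys \<and> zs \<noteq> ys}"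
      have ne: "us \<noteq> []" using us by auto
      have cZ: "countable ?Z" by (rule countable_subset[OF _ countable_lists_states]) auto
      have "measure \<mu> (A \<inter> cyl us) \<le> (1 - p) ^ k * measure \<mu> (\<Union>zs\<in>?Z. cyl (us @ zs))"
      proof (rule measure_Int_cyl_le[OF A cZ])
        show "disjoint_family_on (\<lambda>zs. cyl (us @ zs)) ?Z"
          unfolding disjoint_family_on_def by (intro ballI impI cyl_disjoint) auto
        show "AE \<omega> in \<mu>. \<omega> \<in> A \<inter> cyl us \<longrightarrow> (\<exists>zs\<in>?Z. \<omega> \<in> cyl (us @ zs))"
          using AE_path
        proof eventually_elim
          case (elim \<omega>)
          show ?case
          proof
            assume \<omega>: "\<omega> \<in> A \<inter> cyl us"
            let ?zs = "map (\<lambda>k. \<omega> (length us + k)) [0..<length ys]"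
            have "\<omega> (length us - 1) = s"
              using \<omega> us ne by (auto simp: cyl_def last_conv_nth)
            have "?zs \<noteq> ys"
            proof
              assume "?zs = ys"
              then have "\<forall>k<length ys. \<omega> (length us + k) = ys ! k"
                by (metis (no_types, lifting) add_0 diff_zero length_upt nth_map nth_upt)
              then have "\<exists>i\<ge>N. \<omega> i = s \<and> (\<forall>k<length ys. \<omega> (Suc i + k) = ys ! k)"
                using us \<open>\<omega> (length us - 1) = s\<close>
                by (cases "length us") (auto intro!: exI[of _ "length us - 1"])
              moreover have "\<omega> \<in> A" using \<omega> by simp
              ultimately show False unfolding A_def by blast
            qed
            then show "\<exists>zs\<in>?Z. \<omega> \<in> cyl (us @ zs)"
              using \<omega> elim by (intro bexI[of _ ?zs]) (auto simp: cyl_append_iff)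
          qed
        qed
        show "0 \<le> (1 - p) ^ k" using p1 by simp
        show "measure \<mu> (A \<inter> cyl (us @ zs)) \<le> (1 - p) ^ k * measure \<mu> (cyl (us @ zs))" for zs
          using us by (intro Suc.IH) auto
      qed
      also have "measure \<mu> (\<Union>zs\<in>?Z. cyl (us @ zs)) \<le> measure \<mu> (cyl us - cyl (us @ ys))"
        by (intro finite_measure_mono) (auto simp: cyl_append_iff dest: cyl_eqD
            intro: nth_equalityI)
      also have "\<dots> = (1 - p) * measure \<mu> (cyl us)"
        using cyl_append[of us ys] ne us
        by (subst finite_measure_Diff) (auto simp: measure_cyl_append p_def algebra_simps)
      finally show ?thesis using p1 by (simp add: mult_left_mono mult.assoc mult.left_commute)
    qed
    \<comment> \<open>The search for \<open>s\<close> starts at the last position of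
      \<open>xs\<close> itself, so \<open>zs = []\<close> is the case where \<open>xs\<close>
      already ends in \<open>s\<close>.\<close>
    let ?m = "length xs - 1"
    let ?Z = "{zs \<in> lists (states M). last (xs @ zs) = s \<and> (\<forall>i<length zs. (xs @ zs) ! (?m + i) \<noteq> s)}"
    have ne: "xs \<noteq> []" using Suc.prems by auto
    have cZ: "countable ?Z" by (rule countable_subset[OF _ countable_lists_states]) auto
    have "measure \<mu> (A \<inter> cyl xs) \<le> (1 - p) ^ Suc k * measure \<mu> (\<Union>zs\<in>?Z. cyl (xs @ zs))"
    proof (rule measure_Int_cyl_le[OF A cZ])
      have last_Z: "\<omega> (?m + length zs) = s" "\<forall>i<length zs. \<omega> (?m + i) \<noteq> s"
        if "zs \<in> ?Z" "\<omega> \<in> cyl (xs @ zs)" for zs \<omega>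
      proof -
        have nth: "\<omega> (?m + i) = (xs @ zs) ! (?m + i)" if "i \<le> length zs" for i
          using \<open>\<omega> \<in> cyl (xs @ zs)\<close> that ne by (cases xs) (auto simp: cyl_def)
        have "length (xs @ zs) - 1 = ?m + length zs" using ne by (cases xs) auto
        then have "last (xs @ zs) = (xs @ zs) ! (?m + length zs)"
          using ne by (simp add: last_conv_nth del: last_append)
        then show "\<omega> (?m + length zs) = s" "\<forall>i<length zs. \<omega> (?m + i) \<noteq> s"
          using \<open>zs \<in> ?Z\<close> nth by auto
      qed
      show "disjoint_family_on (\<lambda>zs. cyl (xs @ zs)) ?Z"
        unfolding disjoint_family_on_def
      proof (intro ballI impI)
        fix zs zs' assume Z: "zs \<in> ?Z" "zs' \<in> ?Z" "zs \<noteq> zs'"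
        show "cyl (xs @ zs) \<inter> cyl (xs @ zs') = {}"
        proof (rule ccontr)
          assume "cyl (xs @ zs) \<inter> cyl (xs @ zs') \<noteq> {}"
          then obtain \<omega> where \<omega>: "\<omega> \<in> cyl (xs @ zs)" "\<omega> \<in> cyl (xs @ zs')" by blast
          have "length zs = length zs'"
            using last_Z[OF Z(1) \<omega>(1)] last_Z[OF Z(2) \<omega>(2)] by (metis linorder_neqE_nat)
          then show False using cyl_eqD[OF \<omega>] Z(3) by simp
        qed
      qed
      show "AE \<omega> in \<mu>. \<omega> \<in> A \<inter> cyl xs \<longrightarrow> (\<exists>zs\<in>?Z. \<omega> \<in> cyl (xs @ zs))"
        using AE_path
      proof eventually_elim
        case (elim \<omega>)
        show ?case
        proof
          assume \<omega>: "\<omega> \<in> A \<inter> cyl xs"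
          then have "\<exists>n. \<omega> (?m + n) = s"
            unfolding A_def INFM_nat_le by (auto dest!: spec[of _ ?m] simp: le_iff_add)
          define n where "n = (LEAST n. \<omega> (?m + n) = s)"
          have n: "\<omega> (?m + n) = s" "\<And>i. i < n \<Longrightarrow> \<omega> (?m + i) \<noteq> s"
            using LeastI_ex[OF \<open>\<exists>n. \<omega> (?m + n) = s\<close>] not_less_Least unfolding n_def by auto
          let ?zs = "map (\<lambda>k. \<omega> (length xs + k)) [0..<n]"
          have in_cyl: "\<omega> \<in> cyl (xs @ ?zs)" using \<omega> by (simp add: cyl_append_iff)
          then have nth: "(xs @ ?zs) ! i = \<omega> i" if "i < length xs + n" for i
            using that by (simp add: cyl_def)
          have "length (xs @ ?zs) - 1 = ?m + n" using ne by (cases xs) auto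
          then have "last (xs @ ?zs) = \<omega> (?m + n)"
            using ne nth[of "?m + n"] by (simp add: last_conv_nth del: last_append)
          moreover have "(xs @ ?zs) ! (?m + i) = \<omega> (?m + i)" if "i < n" for i
            using that by (intro nth) auto
          ultimately have "?zs \<in> ?Z" using n elim by auto
          then show "\<exists>zs\<in>?Z. \<omega> \<in> cyl (xs @ zs)" using in_cyl by blast
        qed
      qed
      show "0 \<le> (1 - p) ^ Suc k" using p1 by simp
      show "measure \<mu> (A \<inter> cyl (xs @ zs)) \<le> (1 - p) ^ Suc k * measure \<mu> (cyl (xs @ zs))"
        if "zs \<in> ?Z" for zs
        using that Suc.prems by (intro visit) auto
    qed
    also have "\<dots> \<le> (1 - p) ^ Suc k * measure \<mu> (cyl xs)"
      using p1 cyl_append[of xs] by (intro mult_left_mono finite_measure_mono) auto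
    finally show ?case .
  qed
  have null: "measure \<mu> (A \<inter> cyl xs) = 0" if "N < length xs" for xs
  proof -
    have "(\<lambda>k. (1 - p) ^ k * measure \<mu> (cyl xs)) \<longlonglongrightarrow> 0 * measure \<mu> (cyl xs)"
      using p p1 by (intro tendsto_intros LIMSEQ_realpow_zero) (auto simp: p_def)
    then have "measure \<mu> (A \<inter> cyl xs) \<le> 0"
      using bound[OF that] by (intro LIMSEQ_le_const) auto
    then show ?thesis using measure_nonneg[of \<mu> "A \<inter> cyl xs"] by linarith
  qed
  let ?L = "{xs \<in> lists (states M). N < length xs}"
  have cL: "countable ?L" by (rule countable_subset[OF _ countable_lists_states]) auto
  have "AE \<omega> in \<mu>. \<forall>xs\<in>?L. \<omega> \<notin> A \<inter> cyl xs"
  proof (subst AE_ball_countable[OF cL], intro ballI)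
    fix xs assume "xs \<in> ?L"
    then have "measure \<mu> (A \<inter> cyl xs) = 0" by (intro null) simp
    then show "AE \<omega> in \<mu>. \<omega> \<notin> A \<inter> cyl xs" by (subst (asm) prob_eq_0) auto
  qed
  with AE_path show ?thesis
  proof eventually_elim
    case (elim \<omega>)
    have "map \<omega> [0..<Suc N] \<in> ?L" using elim(1) by auto
    then have "\<omega> \<notin> A" using elim(2) in_cyl_map by blast
    then show ?case unfolding A_def by blast
  qed
qed

text \<open>Only the first \<open>n + 1\<close> values of \<open>\<pi>\<close> matter; encoding them
  as a state and a list leaves countably many null sets.\<close>

lemma AE_finite_paths_recur:
  "AE \<omega> in \<mu>. \<forall>\<pi> n. (\<exists>\<^sub>\<infinity>i. \<omega> i = \<pi> 0) \<and> (\<forall>k<n. edge (\<pi> k) (\<pi> (Suc k))) \<longrightarrow>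
     (\<exists>\<^sub>\<infinity>i. \<forall>k\<le>n. \<omega> (i + k) = \<pi> k)"
proof -
  have "countable (lists (states M))"
    using finite_states by (intro countable_lists countable_finite)
  then have c: "countable (states M \<times> lists (states M))"
    using finite_states by (intro countable_SIGMA) (simp_all add: countable_finite)
  have "AE \<omega> in \<mu>. \<forall>x\<in>states M \<times> lists (states M). 0 < prob_from (fst x) (snd x) \<longrightarrow>
      (\<forall>N. (\<exists>\<^sub>\<infinity>i. \<omega> i = fst x) \<longrightarrow>
        (\<exists>i\<ge>N. \<omega> i = fst x \<and> (\<forall>k<length (snd x). \<omega> (Suc i + k) = snd x ! k)))"
    (is "AE \<omega> in \<mu>. \<forall>x\<in>_. ?pos x \<longrightarrow> (\<forall>N. ?Q \<omega> N x)")
  proof (subst AE_ball_countable[OF c], intro ballI)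
    fix x
    show "AE \<omega> in \<mu>. ?pos x \<longrightarrow> (\<forall>N. ?Q \<omega> N x)"
    proof (cases "?pos x")
      case True
      then have "AE \<omega> in \<mu>. \<forall>N. ?Q \<omega> N x"
        by (subst AE_all_countable) (intro allI visits_without_path_null)
      then show ?thesis by eventually_elim blast
    qed simp
  qed
  with AE_path show ?thesis
  proof eventually_elim
    case (elim \<omega>)
    show ?case
    proof (intro allI impI, elim conjE)
      fix \<pi> n assume inf: "\<exists>\<^sub>\<infinity>i. \<omega> i = \<pi> 0" and edges: "\<forall>k<n. edge (\<pi> k) (\<pi> (Suc k))"
      obtain i where "\<omega> i = \<pi> 0" using INFM_EX[OF inf] by blast
      moreover have "\<omega> i \<in> states M" using elim(1) by blast
      ultimately have "\<pi> 0 \<in> states M" by simp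
      then have st: "\<pi> k \<in> states M" if "k \<le> n" for k
        using that by (induction k) (use edges edge_in in \<open>auto simp: Suc_le_eq\<close>)
      let ?ys = "map (\<lambda>k. \<pi> (Suc k)) [0..<n]"
      have "?ys \<in> lists (states M)" using st by auto
      moreover have "0 < prob_from (\<pi> 0) ?ys"
        by (rule prob_from_pos) (use edges in \<open>auto simp: nth_Cons split: nat.split\<close>)
      ultimately have *: "\<exists>i\<ge>N. \<omega> i = \<pi> 0 \<and> (\<forall>k<length ?ys. \<omega> (Suc i + k) = ?ys ! k)" for N
        using elim(2)[rule_format, of "(\<pi> 0, ?ys)"] inf \<open>\<pi> 0 \<in> states M\<close> by simp
      show "\<exists>\<^sub>\<infinity>i. \<forall>k\<le>n. \<omega> (i + k) = \<pi> k"
        unfolding INFM_nat_le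
      proof
        fix N
        from *[of N] obtain i where i: "i \<ge> N" "\<omega> i = \<pi> 0" "\<forall>k<n. \<omega> (Suc i + k) = \<pi> (Suc k)" by auto
        have "\<omega> (i + k) = \<pi> k" if "k \<le> n" for k
          using i that by (cases k) auto
        with i show "\<exists>i\<ge>N. \<forall>k\<le>n. \<omega> (i + k) = \<pi> k" by blast
      qed
    qed
  qed
qed

section \<open>The bound on the valuation\<close>

text \<open>No component is fixed yet: recurrence is relative to the states that the path itself
  visits infinitely often, and \<open>B\<close> is chosen afterwards.\<close>

definition recurrent :: "(nat \<Rightarrow> 's) \<Rightarrow> bool" where
  "recurrent \<omega> \<longleftrightarrow> \<omega> 0 = init_state M \<and> (\<forall>k. \<omega> k \<in> states M \<and> edge (\<omega> k) (\<omega> (Suc k))) \<and>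
     (\<forall>\<pi> n. (\<exists>\<^sub>\<infinity>i. \<omega> i = \<pi> 0) \<and> (\<forall>k<n. edge (\<pi> k) (\<pi> (Suc k))) \<longrightarrow>
       (\<exists>\<^sub>\<infinity>i. \<forall>k\<le>n. \<omega> (i + k) = \<pi> k))"

lemma AE_recurrent: "AE \<omega> in \<mu>. recurrent \<omega>"
  using AE_init AE_path AE_finite_paths_recur by eventually_elim (auto simp: recurrent_def)

lemma recurrent_reaches:
  assumes "recurrent \<omega>" and inf: "\<exists>\<^sub>\<infinity>i. \<omega> i = \<pi> 0" and edges: "\<And>k. k < n \<Longrightarrow> edge (\<pi> k) (\<pi> (Suc k))"
  shows "\<exists>\<^sub>\<infinity>i. \<omega> i = \<pi> n"
proof -
  have "\<exists>\<^sub>\<infinity>i. \<forall>k\<le>n. \<omega> (i + k) = \<pi> k" using assms unfolding recurrent_def by blast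
  then have "\<exists>\<^sub>\<infinity>i. \<omega> (i + n) = \<pi> n" by (rule INFM_mono) simp
  then show ?thesis by (rule INFM_shift_nat)
qed

lemma infinitely_visited:
  assumes "recurrent \<omega>"
  shows "\<exists>s. \<exists>\<^sub>\<infinity>i. \<omega> i = s"
proof -
  have "finite (\<omega> ` UNIV)"
    using assms finite_states by (auto simp: recurrent_def intro: finite_subset)
  then obtain a where "infinite {i. \<omega> i = \<omega> a}"
    using pigeonhole_infinite[of UNIV \<omega>] by auto
  then show ?thesis by (auto simp: frequently_cofinite)
qed

text \<open>Every edge leaving an infinitely visited state is itself taken infinitely often.\<close>

lemma bottom_infinitely_visited:
  assumes "recurrent \<omega>"
  shows "bottom (states M) edge {s. \<exists>\<^sub>\<infinity>i. \<omega> i = s}"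
proof
  fix s t assume "s \<in> {s. \<exists>\<^sub>\<infinity>i. \<omega> i = s}" "edge s t"
  then show "t \<in> {s. \<exists>\<^sub>\<infinity>i. \<omega> i = s}"
    using recurrent_reaches[OF assms, of "\<lambda>k. if k = 0 then s else t" 1] by auto
qed (rule finite_states)

lemma pr_sat_pos_bounded:
  assumes pos: "pr_sat M v \<phi> > 0" and N: "N = card (states M) * len \<phi> * 2 ^ len \<phi>"
  shows "pr_sat M (\<lambda>_. N) \<phi> > 0"
proof -
  let ?sat = "\<lambda>v \<omega>. sat (\<lambda>k. label M (\<omega> k)) 0 v \<phi>" and ?f = "tr (label M) \<phi>"
  \<comment> \<open>A set of positive probability meets the almost sure event
    \<open>recurrent\<close>.\<close>
  obtain \<omega> where \<omega>: "recurrent \<omega>" "?sat v \<omega>"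
  proof (rule ccontr)
    assume "\<not> thesis"
    then have "AE \<omega> in \<mu>. \<not> ?sat v \<omega>"
      using AE_recurrent that by (auto elim!: eventually_mono)
    then have "prob {\<omega>. ?sat v \<omega>} = 0"
      using sets_sat[of M 0 v \<phi>] by (subst prob_eq_0) auto
    then show False using pos by (simp add: pr_sat_def)
  qed
  define B where "B = {s. \<exists>\<^sub>\<infinity>i. \<omega> i = s}"
  interpret bottom "states M" edge B
    unfolding B_def by (rule bottom_infinitely_visited[OF \<omega>(1)])
  \<comment> \<open>A state \<open>s\<close> that \<open>\<omega>'\<close> visits infinitely often
    lies in \<open>B\<close>, and \<open>\<omega>\<close> provides a path from \<open>s\<close> to
    \<open>\<pi> 0\<close>; hence \<open>\<omega>'\<close> visits \<open>\<pi> 0\<close> infinitely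
    often too.\<close>
  have gen_recurrentI: "gen \<omega>'" if \<omega>': "recurrent \<omega>'" "\<omega>' n \<in> B" for \<omega>' n
    unfolding gen_def
  proof (intro conjI allI impI)
    fix \<pi> l assume \<pi>: "\<pi> 0 \<in> B \<and> (\<forall>k<l. edge (\<pi> k) (\<pi> (Suc k)))"
    have stays: "\<omega>' k \<in> B" if "n \<le> k" for k
      using that by (induction rule: dec_induct) (use \<omega>' closed in \<open>auto simp: recurrent_def\<close>)
    obtain s where s: "\<exists>\<^sub>\<infinity>i. \<omega>' i = s" using infinitely_visited[OF \<omega>'(1)] by blast
    then obtain k where "n \<le> k" "\<omega>' k = s" unfolding INFM_nat_le by blast
    then have "\<exists>\<^sub>\<infinity>i. \<omega> i = s" using stays[of k] by (simp add: B_def)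
    then obtain i where i: "\<omega> i = s" using INFM_EX by blast
    from \<pi> have "\<exists>\<^sub>\<infinity>i. \<omega> i = \<pi> 0" by (simp add: B_def)
    then obtain j where j: "i \<le> j" "\<omega> j = \<pi> 0" unfolding INFM_nat_le by blast
    have "\<exists>\<^sub>\<infinity>l. \<omega>' l = \<omega> (i + (j - i))"
      by (rule recurrent_reaches[OF \<omega>'(1), where \<pi> = "\<lambda>k. \<omega> (i + k)"])
        (use s i \<omega>(1) in \<open>auto simp: recurrent_def\<close>)
    then show "\<exists>\<^sub>\<infinity>i. \<forall>k\<le>l. \<omega>' (i + k) = \<pi> k"
      using \<omega>'(1) \<pi> j unfolding recurrent_def by simp
  qed (use \<omega>' in \<open>auto simp: recurrent_def\<close>)
  obtain s where "\<exists>\<^sub>\<infinity>i. \<omega> i = s" using infinitely_visited[OF \<omega>(1)] by blast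
  then obtain n0 where "\<omega> n0 \<in> B" by (auto simp: B_def dest: INFM_EX)
  then have gen: "gen \<omega>" using gen_recurrentI[OF \<omega>(1)] by blast
  \<comment> \<open>\<open>u\<close> dominates \<open>N\<close>, as the transfer requires, and
    \<open>v\<close> on the finitely many variables of \<open>\<phi>\<close>; inserting
    \<open>0\<close> keeps the set nonempty.\<close>
  define u where "u = max N (Max (insert 0 (v ` set2_pltl \<phi>)))"
  have fin: "finite (set2_pltl \<phi>)" by (induction \<phi>) auto
  have "v x \<le> u" if "x \<in> set2_pltl \<phi>" for x
    unfolding u_def using that fin by (intro max.coboundedI2 Max_ge) auto
  then have "fsat u \<omega> 0 ?f"
    using sat_mono[OF \<omega>(2), of "\<lambda>_. u"] by (simp add: fsat_tr)
  \<comment> \<open>\<open>card (tsub ?f) < len \<phi>\<close> is used twice: for the linear factor,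
    and in the exponent, where it gives strictness.\<close>
  moreover have "card (states M) * 2 ^ card (tsub ?f) * Suc (card (tsub ?f)) < N"
  proof -
    have L: "Suc (card (tsub ?f)) \<le> len \<phi>" using card_tsub_tr[of "label M" \<phi>] by simp
    have m: "0 < card (states M)" using finite_states init_in by (auto simp: card_gt_0_iff)
    have "card (states M) * 2 ^ card (tsub ?f) * Suc (card (tsub ?f)) \<le>
        card (states M) * 2 ^ card (tsub ?f) * len \<phi>"
      by (rule mult_le_mono2[OF L])
    also have "\<dots> < card (states M) * 2 ^ len \<phi> * len \<phi>"
      using L m by simp
    finally show ?thesis by (simp add: N algebra_simps)
  qed
  moreover have "N \<le> u" by (simp add: u_def)
  ultimately obtain \<omega>1 n1 where \<omega>1: "gen \<omega>1" "\<omega>1 0 = \<omega> 0"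
    "\<forall>\<omega>'. gen \<omega>' \<and> (\<forall>k\<le>n1. \<omega>' k = \<omega>1 k) \<longrightarrow> fsat N \<omega>' 0 ?f"
    using bound_transfer[of ?f N u, THEN conjunct1] gen Alw_notin_tsub_tr[of _ "label M" \<phi>] by blast
  \<comment> \<open>The prefix is prolonged into \<open>B\<close>, so that every recurrent path in
    its cylinder is generic.\<close>
  obtain n where n: "n \<ge> n1" "\<omega>1 n \<in> B" using gen_reaches_after[OF \<omega>1(1)] by blast
  have "AE \<omega>' in \<mu>. \<omega>' \<in> {\<omega>'. \<forall>i\<le>n. \<omega>' i = \<omega>1 i} \<longrightarrow> \<omega>' \<in> {\<omega>'. ?sat (\<lambda>_. N) \<omega>'}"
    using AE_recurrent
  proof eventually_elim
    case (elim \<omega>')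
    show ?case
    proof
      assume *: "\<omega>' \<in> {\<omega>'. \<forall>i\<le>n. \<omega>' i = \<omega>1 i}"
      then have "gen \<omega>'" using gen_recurrentI[OF elim, of n] n by simp
      then have "fsat N \<omega>' 0 ?f" using \<omega>1(3) * n by auto
      then show "\<omega>' \<in> {\<omega>'. ?sat (\<lambda>_. N) \<omega>'}" by (simp add: fsat_tr)
    qed
  qed
  then have "emeasure \<mu> {\<omega>'. \<forall>i\<le>n. \<omega>' i = \<omega>1 i} \<le> emeasure \<mu> {\<omega>'. ?sat (\<lambda>_. N) \<omega>'}"
    by (intro emeasure_mono_AE sets_sat)
  moreover have "\<omega>1 0 = init_state M" using \<omega>1(2) \<omega>(1) by (simp add: recurrent_def)
  then have "emeasure \<mu> {\<omega>'. \<forall>i\<le>n. \<omega>' i = \<omega>1 i} > 0"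
    using gen_edge[OF \<omega>1(1)]
    by (simp add: emeasure_path_measure_cylinder prod_ennreal prod_pos pmf_positive)
  ultimately show ?thesis
    by (simp add: pr_sat_def emeasure_eq_measure)
qed

end

theorem theorem4:
  fixes M :: "('s, 'ap) markov_chain" and \<phi> :: "('ap, 'x) pltl"
  assumes "finite_markov_chain M"
  shows "V_pos M \<phi> \<noteq> {} \<longleftrightarrow> (\<lambda>x. card (states M) * len \<phi> * 2 ^ len \<phi>) \<in> V_pos M \<phi>"
proof -
  interpret finite_chain M by standard (rule assms)
  show ?thesis using pr_sat_pos_bounded by (auto simp: V_pos_def)
qed

end
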